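(* Let $\mathcal{C}\leq RG$ be a relative projective group code. Then there exist primitive, (pairwise) orthogonal idempotents $\epsilon_1,\dots,\epsilon_s\in RG$ and $a_1,\dots,a_s\in\mathbb{N}_0$ such that $$\mathcal{C}=\bigoplus_{i=1}^s \pi^{a_i}RG\,\epsilon_i .$$
   Context: $R$ is a commutative Artinian chain ring with $1$, with maximal ideal $\mathfrak{m}=\pi R$ ($\pi$ a fixed generator) and residue field $\mathbb{F}=R/\mathfrak{m}$, a finite field of characteristic $p$. $G$ is a finite group and $RG$ is the group ring. A group code over $R$ is a left ideal $\mathcal{C}$ in $RG$; it is called relative projective if it is relative projective for the subgroup $\{1\}$ of $G$, i.e. for any short exact sequence $0\to\mathcal{M}\to\mathcal{N}\xrightarrow{\varphi}\mathcal{C}\to 0$ of (left) $RG$-modules for which there is an $R$-module homomorphism $\psi:\mathcal{C}\to\mathcal{N}$ with $\varphi\circ\psi=\mathrm{id}_{\mathcal{C}}$, there is an $RG$-module homomorphism $\psi':\mathcal{C}\to\mathcal{N}$ with $\varphi\circ\psi'=\mathrm{id}_{\mathcal{C}}$. *)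

theory Defs
  imports "HOL-Algebra.Module" "HOL-Library.Poly_Mapping"
begin

section \<open>Artinian chain rings\<close>

text \<open>Over a commutative ring this is the notion of an ideal.\<close>

definition left_ideal :: "'a::ring_1 set \<Rightarrow> bool" where
  "left_ideal I \<longleftrightarrow> 0 \<in> I \<and> (\<forall>x\<in>I. \<forall>y\<in>I. x + y \<in> I) \<and> (\<forall>a. \<forall>x\<in>I. a * x \<in> I)"

definition maximal_ideal :: "'r::comm_ring_1 set \<Rightarrow> bool" where
  "maximal_ideal I \<longleftrightarrow> left_ideal I \<and> I \<noteq> UNIV \<and>
     (\<forall>J. left_ideal J \<and> I \<subseteq> J \<longrightarrow> J = I \<or> J = UNIV)"

definition artinian_ring :: "'r::comm_ring_1 itself \<Rightarrow> bool" where
  "artinian_ring _ \<longleftrightarrow>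
     (\<forall>I :: nat \<Rightarrow> 'r set. (\<forall>n. left_ideal (I n) \<and> I (Suc n) \<subseteq> I n) \<longrightarrow>
        (\<exists>k. \<forall>n\<ge>k. I n = I k))"

definition chain_ring :: "'r::comm_ring_1 itself \<Rightarrow> bool" where
  "chain_ring _ \<longleftrightarrow>
     (\<forall>I J :: 'r set. left_ideal I \<and> left_ideal J \<longrightarrow> I \<subseteq> J \<or> J \<subseteq> I)"

definition residue_classes :: "'r::comm_ring_1 set \<Rightarrow> 'r set set" where
  "residue_classes I = UNIV // {(x, y). x - y \<in> I}"

text \<open>
  The characteristic of the quotient ring by I is p: the image of n is zero in the quotient iff
  p divides n.
\<close>

definition residue_char :: "'r::comm_ring_1 set \<Rightarrow> nat \<Rightarrow> bool" where
  "residue_char I p \<longleftrightarrow> (\<forall>n. of_nat n \<in> I \<longleftrightarrow> p dvd n)"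

section \<open>Group rings and their left modules\<close>

text \<open>
  The class \<open>group_add\<close> does not assume commutativity. For a finite group G written additively,
  \<open>'g \<Rightarrow>\<^sub>0 'r\<close> with the convolution product of \<open>Poly_Mapping\<close> is the group ring RG,
  \<open>Poly_Mapping.single g 1\<close> being the group element g. Its subring R consists of the multiples
  of the neutral element.
\<close>

abbreviation scalar :: "'r::comm_ring_1 \<Rightarrow> ('g::group_add \<Rightarrow>\<^sub>0 'r)" where
  "scalar r \<equiv> Poly_Mapping.single 0 r"

text \<open>
  The library's locale \<open>module\<close> requires commutative scalars, so we repeat its axioms for left
  modules over a ring given as a type. Of the record only the carrier, the additive structure and
  the scalar multiplication are relevant.
\<close>

locale left_module = abelian_group M for M :: "('a::ring_1, 'n) module" (structure) +
  assumes smult_closed [simp, intro]: "x \<in> carrier M \<Longrightarrow> a \<odot> x \<in> carrier M"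
    and smult_l_distr: "x \<in> carrier M \<Longrightarrow> (a + b) \<odot> x = a \<odot> x \<oplus> b \<odot> x"
    and smult_r_distr:
      "\<lbrakk>x \<in> carrier M; y \<in> carrier M\<rbrakk> \<Longrightarrow> a \<odot> (x \<oplus> y) = a \<odot> x \<oplus> a \<odot> y"
    and smult_assoc: "x \<in> carrier M \<Longrightarrow> (a * b) \<odot> x = a \<odot> (b \<odot> x)"
    and smult_one [simp]: "x \<in> carrier M \<Longrightarrow> 1 \<odot> x = x"

definition linear_over ::
    "'a::ring_1 set \<Rightarrow> ('a, 'm) module \<Rightarrow> ('a, 'n) module \<Rightarrow> ('m \<Rightarrow> 'n) \<Rightarrow> bool" where
  "linear_over S M N f \<longleftrightarrow> f \<in> carrier M \<rightarrow> carrier N \<and>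
     (\<forall>x\<in>carrier M. \<forall>y\<in>carrier M. f (x \<oplus>\<^bsub>M\<^esub> y) = f x \<oplus>\<^bsub>N\<^esub> f y) \<and>
     (\<forall>a\<in>S. \<forall>x\<in>carrier M. f (a \<odot>\<^bsub>M\<^esub> x) = a \<odot>\<^bsub>N\<^esub> f x)"

definition short_exact ::
    "('a::ring_1, 'l) module \<Rightarrow> ('a, 'm) module \<Rightarrow> ('a, 'n) module \<Rightarrow> ('l \<Rightarrow> 'm) \<Rightarrow> ('m \<Rightarrow> 'n) \<Rightarrow> bool"
  where
  "short_exact L M N \<iota> \<phi> \<longleftrightarrow> linear_over UNIV L M \<iota> \<and> linear_over UNIV M N \<phi> \<and>
     inj_on \<iota> (carrier L) \<and> \<phi> ` carrier M = carrier N \<and>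
     \<iota> ` carrier L = {x \<in> carrier M. \<phi> x = \<zero>\<^bsub>N\<^esub>}"

definition ideal_module :: "'a::ring_1 set \<Rightarrow> ('a, 'a) module" where
  "ideal_module C =
     \<lparr>carrier = C, mult = (*), one = 1, zero = 0, add = (+), smult = (*)\<rparr>"

section \<open>Relative projectivity\<close>

text \<open>
  HOL cannot quantify over all modules inside a formula; here the modules M and N range over all
  module structures whose carrier is a subset of the type \<open>'n\<close>.
\<close>

definition relative_projective_in ::
    "'n itself \<Rightarrow> ('g::{group_add,finite} \<Rightarrow>\<^sub>0 'r::comm_ring_1) set \<Rightarrow> bool" where
  "relative_projective_in _ C \<longleftrightarrow>
     (\<forall>(M :: ('g \<Rightarrow>\<^sub>0 'r, 'n) module) (N :: ('g \<Rightarrow>\<^sub>0 'r, 'n) module) \<iota> \<phi>.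
        left_module M \<and> left_module N \<and> short_exact M N (ideal_module C) \<iota> \<phi> \<and>
        (\<exists>\<psi>. linear_over (range scalar) (ideal_module C) N \<psi> \<and> (\<forall>c\<in>C. \<phi> (\<psi> c) = c)) \<longrightarrow>
        (\<exists>\<psi>'. linear_over UNIV (ideal_module C) N \<psi>' \<and> (\<forall>c\<in>C. \<phi> (\<psi>' c) = c)))"

text \<open>
  Modules with carrier in the type of functions from G to RG suffice: by the lemma
  \<open>relative_projective_any_type\<close> below, the condition over this type implies the condition
  over every type.
\<close>

definition relative_projective :: "('g::{group_add,finite} \<Rightarrow>\<^sub>0 'r::comm_ring_1) set \<Rightarrow> bool" where
  "relative_projective C \<longleftrightarrow> relative_projective_in TYPE('g \<Rightarrow> ('g \<Rightarrow>\<^sub>0 'r)) C"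

section \<open>Idempotents and direct sums\<close>

definition primitive_idempotent :: "'a::ring_1 \<Rightarrow> bool" where
  "primitive_idempotent e \<longleftrightarrow> e * e = e \<and> e \<noteq> 0 \<and>
     (\<forall>f g. f * f = f \<and> g * g = g \<and> f * g = 0 \<and> g * f = 0 \<and> e = f + g \<longrightarrow> f = 0 \<or> g = 0)"

text \<open>Every element of C is a sum of elements of the D i in exactly one way.\<close>

definition is_direct_sum :: "'i set \<Rightarrow> ('i \<Rightarrow> 'a::comm_monoid_add set) \<Rightarrow> 'a set \<Rightarrow> bool" where
  "is_direct_sum I D C \<longleftrightarrow> bij_betw (\<lambda>x. \<Sum>i\<in>I. x i) (Pi\<^sub>E I D) C"

section \<open>Independence of the carrier type\<close>

text \<open>The module induced from the restriction of C to R, realised on functions from G to C.\<close>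

definition ind_module ::
    "('g::{group_add,finite} \<Rightarrow>\<^sub>0 'r::comm_ring_1) set \<Rightarrow> ('g \<Rightarrow>\<^sub>0 'r, 'g \<Rightarrow> ('g \<Rightarrow>\<^sub>0 'r)) module" where
  "ind_module C =
     \<lparr>carrier = {F. \<forall>h. F h \<in> C}, mult = undefined, one = undefined, zero = (\<lambda>_. 0),
      add = (\<lambda>F H h. F h + H h),
      smult = (\<lambda>a F h. \<Sum>g\<in>UNIV. scalar (Poly_Mapping.lookup a g) * F (- g + h))\<rparr>"

lemma poly_mapping_sum_single:
  fixes a :: "'g::finite \<Rightarrow>\<^sub>0 'r::comm_monoid_add"
  shows "a = (\<Sum>g\<in>UNIV. Poly_Mapping.single g (Poly_Mapping.lookup a g))"
  by (rule poly_mapping_eqI)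
    (simp add: lookup_sum lookup_single when_def)

lemma group_ring_induct [case_names single sum]:
  fixes a :: "'g::finite \<Rightarrow>\<^sub>0 'r::comm_monoid_add"
  assumes single: "\<And>k v. P (Poly_Mapping.single k v)" and sum: "\<And>p q. P p \<Longrightarrow> P q \<Longrightarrow> P (p + q)"
  shows "P a"
proof -
  have "P (\<Sum>g\<in>A. Poly_Mapping.single g (Poly_Mapping.lookup a g))" if "finite A" for A
    using that
  proof (induction A rule: finite_induct)
    case empty
    show ?case using single[of undefined 0] by simp
  qed (simp add: single sum)
  then show ?thesis using poly_mapping_sum_single[of a] by (metis finite)
qed

lemma lookup_times_group:
  fixes a b :: "'g::{group_add,finite} \<Rightarrow>\<^sub>0 'r::comm_ring_1"
  shows "Poly_Mapping.lookup (a * b) h =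
    (\<Sum>g\<in>UNIV. Poly_Mapping.lookup a g * Poly_Mapping.lookup b (- g + h))"
proof -
  have 1: "Poly_Mapping.lookup (Poly_Mapping.single g v * b) h = v * Poly_Mapping.lookup b (- g + h)"
    for g v
  proof (induction b rule: group_ring_induct)
    case (single k w)
    have "g + k = h \<longleftrightarrow> k = - g + h"
      by (metis add.assoc add_left_cancel add.left_neutral right_minus)
    then show ?case by (simp add: mult_single lookup_single when_def)
  next
    case (sum p q)
    then show ?case by (simp add: algebra_simps lookup_add)
  qed
  have "a * b = (\<Sum>g\<in>UNIV. Poly_Mapping.single g (Poly_Mapping.lookup a g) * b)"
    by (subst poly_mapping_sum_single[of a]) (simp add: sum_distrib_right)
  then show ?thesis by (simp add: lookup_sum 1)
qed

lemma scalar_sum: "scalar (sum f I) = (\<Sum>i\<in>I. scalar (f i))"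
  by (induction I rule: infinite_finite_induct) (auto simp: single_add)

lemma left_ideal_sum: "left_ideal C \<Longrightarrow> (\<And>i. i \<in> I \<Longrightarrow> f i \<in> C) \<Longrightarrow> sum f I \<in> C"
  by (induction I rule: infinite_finite_induct) (auto simp: left_ideal_def)

lemma left_ideal_uminus: "left_ideal C \<Longrightarrow> x \<in> C \<Longrightarrow> - x \<in> C"
  unfolding left_ideal_def by (metis mult_minus1)

lemma left_module_ideal: 
  assumes "left_ideal C" shows "left_module (ideal_module C)"
proof -
  have "abelian_group (ideal_module C)"
    by (rule abelian_groupI)
      (use assms in \<open>auto simp: ideal_module_def left_ideal_def add.assoc add.commute
        intro!: bexI[of _ "- x" for x] left_ideal_uminus[OF assms]\<close>)
  then show ?thesis
    by (rule left_module.intro, unfold_locales)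
      (use assms in \<open>auto simp: ideal_module_def left_ideal_def algebra_simps\<close>)
qed

lemma left_module_ind:
  assumes C: "left_ideal C" shows "left_module (ind_module C)"
proof -
  have ag: "abelian_group (ind_module C)"
  proof (rule abelian_groupI)
    fix x assume x: "x \<in> carrier (ind_module C)"
    show "\<exists>y\<in>carrier (ind_module C). y \<oplus>\<^bsub>ind_module C\<^esub> x = \<zero>\<^bsub>ind_module C\<^esub>"
      by (rule bexI[of _ "\<lambda>h. - x h"])
        (use x in \<open>auto simp: ind_module_def left_ideal_uminus[OF C]\<close>)
  qed (use C in \<open>auto simp: ind_module_def left_ideal_def add.assoc add.commute\<close>)
  show ?thesis
  proof (rule left_module.intro[OF ag], unfold_locales)
    fix a b :: "'a \<Rightarrow>\<^sub>0 'b" and x y :: "'a \<Rightarrow> 'a \<Rightarrow>\<^sub>0 'b"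
    assume x: "x \<in> carrier (ind_module C)"
    show "a \<odot>\<^bsub>ind_module C\<^esub> x \<in> carrier (ind_module C)"
      using x C by (auto simp: ind_module_def intro!: left_ideal_sum[OF C])
        (auto simp: left_ideal_def)
    show "(a + b) \<odot>\<^bsub>ind_module C\<^esub> x = a \<odot>\<^bsub>ind_module C\<^esub> x \<oplus>\<^bsub>ind_module C\<^esub> b \<odot>\<^bsub>ind_module C\<^esub> x"
      by (simp add: ind_module_def lookup_add single_add algebra_simps sum.distrib)
    show "a \<odot>\<^bsub>ind_module C\<^esub> (x \<oplus>\<^bsub>ind_module C\<^esub> y) = a \<odot>\<^bsub>ind_module C\<^esub> x \<oplus>\<^bsub>ind_module C\<^esub> a \<odot>\<^bsub>ind_module C\<^esub> y"
      by (simp add: ind_module_def algebra_simps sum.distrib)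
    show "1 \<odot>\<^bsub>ind_module C\<^esub> x = x"
    proof
      fix h
      have "(1 \<odot>\<^bsub>ind_module C\<^esub> x) h = (\<Sum>g\<in>(UNIV::'a set). (if g = 0 then x h else 0))"
        unfolding ind_module_def module.simps by (rule sum.cong[OF refl]) (simp add: lookup_one when_def)
      then show "(1 \<odot>\<^bsub>ind_module C\<^esub> x) h = x h" by simp
    qed
    show "(a * b) \<odot>\<^bsub>ind_module C\<^esub> x = a \<odot>\<^bsub>ind_module C\<^esub> (b \<odot>\<^bsub>ind_module C\<^esub> x)"
    proof
      fix h
      let ?a = "Poly_Mapping.lookup a" and ?b = "Poly_Mapping.lookup b"
      have "((a * b) \<odot>\<^bsub>ind_module C\<^esub> x) h
          = (\<Sum>k\<in>UNIV. \<Sum>g\<in>UNIV. scalar (?a g * ?b (- g + k)) * x (- k + h))"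
        by (simp add: ind_module_def lookup_times_group sum_distrib_right scalar_sum)
      also have "\<dots> = (\<Sum>g\<in>UNIV. \<Sum>k\<in>UNIV. scalar (?a g * ?b (- g + k)) * x (- k + h))"
        by (rule sum.swap)
      also have "\<dots> = (\<Sum>g\<in>UNIV. \<Sum>k\<in>UNIV. scalar (?a g * ?b k) * x (- k + (- g + h)))"
      proof (rule sum.cong[OF refl])
        fix g
        show "(\<Sum>k\<in>UNIV. scalar (?a g * ?b (- g + k)) * x (- k + h)) =
              (\<Sum>k\<in>UNIV. scalar (?a g * ?b k) * x (- k + (- g + h)))"
          by (rule sum.reindex_bij_witness[of _ "\<lambda>k. g + k" "\<lambda>k. - g + k"])
            (auto simp: minus_add add.assoc)
      qed
      also have "\<dots> = (a \<odot>\<^bsub>ind_module C\<^esub> (b \<odot>\<^bsub>ind_module C\<^esub> x)) h"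
        by (simp add: ind_module_def sum_distrib_left mult_single flip: mult.assoc)
      finally show "((a * b) \<odot>\<^bsub>ind_module C\<^esub> x) h = (a \<odot>\<^bsub>ind_module C\<^esub> (b \<odot>\<^bsub>ind_module C\<^esub> x)) h" .
    qed
  qed
qed


lemma ind_smult_single:
  "Poly_Mapping.single g r \<odot>\<^bsub>ind_module C\<^esub> F = (\<lambda>h. scalar r * F (- g + h))"
proof
  fix h
  have "(Poly_Mapping.single g r \<odot>\<^bsub>ind_module C\<^esub> F) h
      = (\<Sum>k\<in>UNIV. if k = g then scalar r * F (- g + h) else 0)"
    unfolding ind_module_def module.simps by (rule sum.cong[OF refl]) (simp add: lookup_single when_def)
  then show "(Poly_Mapping.single g r \<odot>\<^bsub>ind_module C\<^esub> F) h = scalar r * F (- g + h)" by simp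
qed

lemma linear_over_singleI:
  fixes M :: "('g::{group_add,finite} \<Rightarrow>\<^sub>0 'r::comm_ring_1, 'm) module"
    and N :: "('g \<Rightarrow>\<^sub>0 'r, 'n) module"
  assumes M: "left_module M" and N: "left_module N" and f: "f \<in> carrier M \<rightarrow> carrier N"
    and add: "\<And>x y. x \<in> carrier M \<Longrightarrow> y \<in> carrier M \<Longrightarrow> f (x \<oplus>\<^bsub>M\<^esub> y) = f x \<oplus>\<^bsub>N\<^esub> f y"
    and single: "\<And>g r x. x \<in> carrier M \<Longrightarrow>
      f (Poly_Mapping.single g r \<odot>\<^bsub>M\<^esub> x) = Poly_Mapping.single g r \<odot>\<^bsub>N\<^esub> f x"
  shows "linear_over UNIV M N f"
proof -
  interpret M: left_module M by fact
  interpret N: left_module N by fact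
  have "f (a \<odot>\<^bsub>M\<^esub> x) = a \<odot>\<^bsub>N\<^esub> f x" if x: "x \<in> carrier M" for a x
  proof (induction a rule: group_ring_induct)
    case (single k v)
    show ?case by (rule assms(5)[OF x])
  next
    case (sum p q)
    have "f x \<in> carrier N" using f x by auto
    then show ?case using sum x
      by (simp add: M.smult_l_distr N.smult_l_distr add)
  qed
  then show ?thesis using f add by (auto simp: linear_over_def)
qed

lemma relative_projective_any_type:
  fixes C :: "('g::{group_add,finite} \<Rightarrow>\<^sub>0 'r::comm_ring_1) set"
  assumes C: "left_ideal C" and rp: "relative_projective C"
  shows "relative_projective_in TYPE('n) C"
  unfolding relative_projective_in_def
proof (intro allI impI, elim conjE exE)
  fix M N :: "('g \<Rightarrow>\<^sub>0 'r, 'n) module" and \<iota> \<phi> \<psi>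
  assume "left_module M" and N: "left_module N"
    and ex: "short_exact M N (ideal_module C) \<iota> \<phi>"
    and \<psi>: "linear_over (range scalar) (ideal_module C) N \<psi>" and \<phi>\<psi>: "\<forall>c\<in>C. \<phi> (\<psi> c) = c"
  interpret N: left_module N by fact
  let ?I = "ind_module C" and ?C = "ideal_module C"
  have CM: "left_module ?C" by (rule left_module_ideal[OF C])
  have IM: "left_module ?I" by (rule left_module_ind[OF C])
  have C0: "0 \<in> C" and Cadd: "\<And>x y. x \<in> C \<Longrightarrow> y \<in> C \<Longrightarrow> x + y \<in> C"
    and Cmult: "\<And>a x. x \<in> C \<Longrightarrow> a * x \<in> C"
    using C by (auto simp: left_ideal_def)
  define \<phi>0 where "\<phi>0 F = (\<Sum>h\<in>UNIV. Poly_Mapping.single h 1 * F h)" for F :: "'g \<Rightarrow> 'g \<Rightarrow>\<^sub>0 'r"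
  define \<psi>0 where "\<psi>0 c = (\<lambda>h::'g. if h = 0 then c else 0)" for c :: "'g \<Rightarrow>\<^sub>0 'r"
  have \<phi>0: "linear_over UNIV ?I ?C \<phi>0"
  proof (rule linear_over_singleI[OF IM CM])
    show "\<phi>0 \<in> carrier ?I \<rightarrow> carrier ?C"
      by (auto simp: \<phi>0_def ind_module_def ideal_module_def intro!: left_ideal_sum[OF C] Cmult)
    show "\<phi>0 (F \<oplus>\<^bsub>?I\<^esub> H) = \<phi>0 F \<oplus>\<^bsub>?C\<^esub> \<phi>0 H" for F H
      by (simp add: \<phi>0_def ind_module_def ideal_module_def algebra_simps sum.distrib)
    fix g :: 'g and r :: 'r and F :: "'g \<Rightarrow> 'g \<Rightarrow>\<^sub>0 'r"
    have "\<phi>0 (Poly_Mapping.single g r \<odot>\<^bsub>?I\<^esub> F)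
        = (\<Sum>h\<in>UNIV. Poly_Mapping.single h r * F (- g + h))"
      by (simp add: \<phi>0_def ind_smult_single mult_single flip: mult.assoc)
    also have "\<dots> = (\<Sum>k\<in>UNIV. Poly_Mapping.single (g + k) r * F k)"
      by (rule sum.reindex_bij_witness[of _ "\<lambda>k. g + k" "\<lambda>k. - g + k"])
        (auto simp flip: add.assoc)
    also have "\<dots> = Poly_Mapping.single g r * \<phi>0 F"
      by (simp add: \<phi>0_def sum_distrib_left mult_single flip: mult.assoc)
    finally show "\<phi>0 (Poly_Mapping.single g r \<odot>\<^bsub>?I\<^esub> F) = Poly_Mapping.single g r \<odot>\<^bsub>?C\<^esub> \<phi>0 F"
      by (simp add: ideal_module_def)
  qed
  have \<psi>0: "linear_over (range scalar) ?C ?I \<psi>0"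
  proof -
    have "\<psi>0 (scalar r * c) = scalar r \<odot>\<^bsub>?I\<^esub> \<psi>0 c" for r c
      by (auto simp: ind_smult_single \<psi>0_def)
    moreover have "\<psi>0 (x + y) = \<psi>0 x \<oplus>\<^bsub>?I\<^esub> \<psi>0 y" for x y
      by (auto simp: \<psi>0_def ind_module_def)
    moreover have "\<psi>0 \<in> C \<rightarrow> carrier ?I"
      by (auto simp: \<psi>0_def ind_module_def C0)
    ultimately show ?thesis by (auto simp: linear_over_def ideal_module_def)
  qed
  have \<phi>0\<psi>0: "\<phi>0 (\<psi>0 c) = c" for c
  proof -
    have "\<phi>0 (\<psi>0 c) = (\<Sum>h\<in>(UNIV::'g set). if h = 0 then c else 0)"
      unfolding \<phi>0_def \<psi>0_def by (rule sum.cong[OF refl]) simp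
    then show ?thesis by simp
  qed
  interpret I: left_module ?I by (rule IM)
  define K where "K = ?I\<lparr>carrier := {F \<in> carrier ?I. \<phi>0 F = 0}\<rparr>"
  have \<phi>0': "\<phi>0 (F \<oplus>\<^bsub>?I\<^esub> H) = \<phi>0 F + \<phi>0 H" "\<phi>0 (a \<odot>\<^bsub>?I\<^esub> F) = a * \<phi>0 F"
    if "F \<in> carrier ?I" "H \<in> carrier ?I" for F H a
    using \<phi>0 that by (auto simp: linear_over_def ideal_module_def)
  have \<phi>00: "\<phi>0 \<zero>\<^bsub>?I\<^esub> = 0" by (simp add: \<phi>0_def ind_module_def)
  have K: "left_module K"
  proof -
    have ag: "abelian_group K"
    proof (rule abelian_groupI)
      fix x assume x: "x \<in> carrier K"
      have "\<phi>0 (\<ominus>\<^bsub>?I\<^esub> x) = 0"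
        using x \<phi>0'(1)[of "\<ominus>\<^bsub>?I\<^esub> x" x] by (simp add: K_def I.l_neg \<phi>00)
      then show "\<exists>y\<in>carrier K. y \<oplus>\<^bsub>K\<^esub> x = \<zero>\<^bsub>K\<^esub>"
        using x by (intro bexI[of _ "\<ominus>\<^bsub>?I\<^esub> x"]) (auto simp: K_def I.l_neg)
    qed (auto simp: K_def \<phi>0' \<phi>00 I.a_ac)
    show ?thesis
      by (rule left_module.intro[OF ag], unfold_locales)
        (auto simp: K_def \<phi>0' I.smult_l_distr I.smult_r_distr I.smult_assoc)
  qed
  have "short_exact K ?I ?C (\<lambda>x. x) \<phi>0"
    unfolding short_exact_def
  proof (intro conjI)
    show "linear_over UNIV K ?I (\<lambda>x. x)" by (auto simp: linear_over_def K_def)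
    show "\<phi>0 ` carrier ?I = carrier ?C"
    proof
      show "\<phi>0 ` carrier ?I \<subseteq> carrier ?C" using \<phi>0 by (auto simp: linear_over_def)
      show "carrier ?C \<subseteq> \<phi>0 ` carrier ?I"
      proof
        fix c assume "c \<in> carrier ?C"
        then have "\<psi>0 c \<in> carrier ?I" using \<psi>0 by (auto simp: linear_over_def)
        then show "c \<in> \<phi>0 ` carrier ?I" using \<phi>0\<psi>0[of c] by force
      qed
    qed
  qed (use \<phi>0 in \<open>auto simp: K_def ideal_module_def\<close>)
  then obtain \<sigma> where \<sigma>: "linear_over UNIV ?C ?I \<sigma>" and \<phi>0\<sigma>: "\<And>c. c \<in> C \<Longrightarrow> \<phi>0 (\<sigma> c) = c"
    using rp K IM \<psi>0 \<phi>0\<psi>0 unfolding relative_projective_def relative_projective_in_def by blast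
  have \<sigma>C: "\<sigma> c h \<in> C" if "c \<in> C" for c h
    using \<sigma> that by (auto simp: linear_over_def ideal_module_def ind_module_def)
  have \<sigma>add: "\<sigma> (c + d) h = \<sigma> c h + \<sigma> d h" if "c \<in> C" "d \<in> C" for c d h
    using \<sigma> that by (simp add: linear_over_def ideal_module_def ind_module_def)
  have \<sigma>single: "\<sigma> (Poly_Mapping.single g r * c) h = scalar r * \<sigma> c (- g + h)" if "c \<in> C" for g r c h
  proof -
    have "\<sigma> (Poly_Mapping.single g r * c) = Poly_Mapping.single g r \<odot>\<^bsub>?I\<^esub> \<sigma> c"
      using \<sigma> that by (simp add: linear_over_def ideal_module_def)
    then show ?thesis by (simp add: ind_smult_single)
  qed
  have \<psi>N: "\<psi> c \<in> carrier N" if "c \<in> C" for c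
    using \<psi> that by (auto simp: linear_over_def ideal_module_def)
  have \<psi>add: "\<psi> (c + d) = \<psi> c \<oplus>\<^bsub>N\<^esub> \<psi> d" if "c \<in> C" "d \<in> C" for c d
    using \<psi> that by (simp add: linear_over_def ideal_module_def)
  have \<psi>scalar: "\<psi> (scalar r * c) = scalar r \<odot>\<^bsub>N\<^esub> \<psi> c" if "c \<in> C" for r c
    using \<psi> that by (simp add: linear_over_def ideal_module_def)
  have \<phi>N: "\<phi> x \<in> C" if "x \<in> carrier N" for x
    using ex that by (auto simp: short_exact_def linear_over_def ideal_module_def)
  have \<phi>add: "\<phi> (x \<oplus>\<^bsub>N\<^esub> y) = \<phi> x + \<phi> y" if "x \<in> carrier N" "y \<in> carrier N" for x y
    using ex that by (simp add: short_exact_def linear_over_def ideal_module_def)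
  have \<phi>smult: "\<phi> (a \<odot>\<^bsub>N\<^esub> x) = a * \<phi> x" if "x \<in> carrier N" for a x
    using ex that by (simp add: short_exact_def linear_over_def ideal_module_def)
  have \<phi>0N: "\<phi> \<zero>\<^bsub>N\<^esub> = 0"
    using \<phi>add[of "\<zero>\<^bsub>N\<^esub>" "\<zero>\<^bsub>N\<^esub>"] by simp
  have \<phi>sum: "\<phi> (finsum N f A) = (\<Sum>h\<in>A. \<phi> (f h))" if "finite A" "f \<in> A \<rightarrow> carrier N"
    for f and A :: "'g set"
    using that by (induction A rule: finite_induct) (auto simp: \<phi>0N \<phi>add Pi_def)
  have smult0: "a \<odot>\<^bsub>N\<^esub> \<zero>\<^bsub>N\<^esub> = \<zero>\<^bsub>N\<^esub>" for a
    using N.smult_r_distr[of "\<zero>\<^bsub>N\<^esub>" "\<zero>\<^bsub>N\<^esub>" a] by simp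
  have smultsum: "a \<odot>\<^bsub>N\<^esub> finsum N f A = finsum N (\<lambda>h. a \<odot>\<^bsub>N\<^esub> f h) A"
    if "finite A" "f \<in> A \<rightarrow> carrier N" for a f and A :: "'g set"
    using that by (induction A rule: finite_induct) (auto simp: smult0 N.smult_r_distr Pi_def)
  define \<psi>' where "\<psi>' c = finsum N (\<lambda>h. Poly_Mapping.single h 1 \<odot>\<^bsub>N\<^esub> \<psi> (\<sigma> c h)) UNIV" for c
  have "linear_over UNIV ?C N \<psi>'"
  proof (rule linear_over_singleI[OF CM N])
    show "\<psi>' \<in> carrier ?C \<rightarrow> carrier N"
      by (auto simp: \<psi>'_def ideal_module_def \<psi>N \<sigma>C)
    show "\<psi>' (c \<oplus>\<^bsub>?C\<^esub> d) = \<psi>' c \<oplus>\<^bsub>N\<^esub> \<psi>' d" if "c \<in> carrier ?C" "d \<in> carrier ?C" for c d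
      using that
      by (simp add: \<psi>'_def ideal_module_def \<sigma>add \<psi>add \<sigma>C \<psi>N N.smult_r_distr N.finsum_addf Pi_def)
    fix g :: 'g and r :: 'r and c assume "c \<in> carrier ?C"
    then have c: "c \<in> C" by (simp add: ideal_module_def)
    have "\<psi>' (Poly_Mapping.single g r * c)
        = finsum N (\<lambda>h. Poly_Mapping.single h r \<odot>\<^bsub>N\<^esub> \<psi> (\<sigma> c (- g + h))) UNIV"
      by (simp add: \<psi>'_def \<sigma>single \<psi>scalar c \<sigma>C \<psi>N mult_single flip: N.smult_assoc)
    also have "\<dots> = finsum N (\<lambda>h. Poly_Mapping.single h r \<odot>\<^bsub>N\<^esub> \<psi> (\<sigma> c (- g + h))) ((\<lambda>k. g + k) ` UNIV)"
      by (simp add: surj_plus)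
    also have "\<dots> = finsum N (\<lambda>k. Poly_Mapping.single (g + k) r \<odot>\<^bsub>N\<^esub> \<psi> (\<sigma> c k)) UNIV"
      by (subst N.finsum_reindex) (auto simp: c \<sigma>C \<psi>N simp flip: add.assoc)
    also have "\<dots> = Poly_Mapping.single g r \<odot>\<^bsub>N\<^esub> \<psi>' c"
      by (simp add: \<psi>'_def smultsum Pi_def c \<sigma>C \<psi>N mult_single flip: N.smult_assoc)
    finally show "\<psi>' (Poly_Mapping.single g r \<odot>\<^bsub>?C\<^esub> c) = Poly_Mapping.single g r \<odot>\<^bsub>N\<^esub> \<psi>' c"
      by (simp add: ideal_module_def)
  qed
  moreover have "\<phi> (\<psi>' c) = c" if c: "c \<in> C" for c
  proof -
    have "\<phi> (\<psi>' c) = \<phi>0 (\<sigma> c)"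
      using \<phi>\<psi> by (simp add: \<psi>'_def \<phi>sum Pi_def c \<sigma>C \<psi>N \<phi>smult \<phi>0_def)
    then show ?thesis using \<phi>0\<sigma>[OF c] by simp
  qed
  ultimately show "\<exists>\<psi>'. linear_over UNIV ?C N \<psi>' \<and> (\<forall>c\<in>C. \<phi> (\<psi>' c) = c)" by blast
qed

end

theory Submission
  imports Defs
begin

text \<open>
  The ring \<open>RG\<close> is finite and \<open>\<pi>\<close> is central and nilpotent in it. By Higman's criterion, applied to
  the projection of the induced module onto \<open>C\<close>, the code \<open>C\<close> has an \<open>R\<close>-linear endomorphism \<open>\<theta>\<close>
  whose trace \<open>\<Sum>g \<theta> g\<^sup>-\<^sup>1\<close> is the identity. As \<open>\<pi>\<^sup>k RG\<close> is the annihilator of \<open>\<pi>\<^sup>n\<^sup>-\<^sup>k\<close>, \<open>\<theta>\<close> preserves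
  \<open>C \<inter> \<pi>\<^sup>k RG\<close>, so it acts on the layers \<open>{x mod \<pi> | \<pi>\<^sup>k x \<in> C}\<close>, and these left ideals of the group
  ring over the residue field are direct summands. Hence they are generated by the classes of nested
  idempotents of \<open>RG\<close>. The differences \<open>e\<^sub>k\<close> of consecutive ones are orthogonal, and there is a unit
  \<open>u\<close>, congruent to 1 modulo \<open>\<pi>\<close>, such that \<open>C\<close> is the sum of the \<open>\<pi>\<^sup>k RG e\<^sub>k u\<close>. It remains
  to split the conjugates \<open>u\<^sup>-\<^sup>1 e\<^sub>k u\<close> into primitive idempotents.
\<close>

lemma finite_idempotent_power:
  fixes x :: "'a::monoid_mult"
  assumes "finite (UNIV :: 'a set)"
  obtains m where "m > 0" "x ^ m * x ^ m = x ^ m"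
proof -
  have "\<not> inj (\<lambda>i::nat. x ^ i)"
    using assms by (meson finite_imageD finite_subset infinite_UNIV_nat subset_UNIV)
  then obtain i j :: nat where "x ^ i = x ^ j" "i \<noteq> j" by (auto simp: inj_def)
  then obtain i j :: nat where ij: "x ^ i = x ^ j" "i < j"
    by (metis nat_neq_iff)
  define p where "p = j - i"
  have step: "x ^ (k + p) = x ^ k" if "k \<ge> i" for k
  proof -
    have "x ^ (k + p) = x ^ (k - i) * x ^ j"
      using that ij by (simp add: p_def flip: power_add)
    also have "\<dots> = x ^ k" using that by (simp add: ij(1)[symmetric] flip: power_add)
    finally show ?thesis .
  qed
  have steps: "x ^ (k + q * p) = x ^ k" if "k \<ge> i" for k q
  proof (induction q)
    case (Suc q)
    have "x ^ (k + Suc q * p) = x ^ ((k + q * p) + p)" by (simp add: algebra_simps)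
    then show ?case using Suc step[of "k + q * p"] that by simp
  qed simp
  have p: "p > 0" using ij by (simp add: p_def)
  then have "Suc i * p \<ge> i"
    by (metis Suc_leD Suc_leI mult.right_neutral mult_le_mono2 One_nat_def)
  from steps[OF this, of "Suc i"] p show thesis
    by (intro that[of "Suc i * p"]) (auto simp: power_add)
qed

definition orthogonal_idempotents :: "'a::ring_1 set \<Rightarrow> bool" where
  "orthogonal_idempotents E \<longleftrightarrow>
     (\<forall>x\<in>E. x * x = x) \<and> (\<forall>x\<in>E. \<forall>y\<in>E. x \<noteq> y \<longrightarrow> x * y = 0)"

lemma orthogonal_idempotents_sum:
  assumes "orthogonal_idempotents E" "finite E" "x \<in> E"
  shows "x * \<Sum>E = x" "\<Sum>E * x = x"
proof -
  have "x * \<Sum>E = (\<Sum>y\<in>E. if y = x then x else 0)"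
    using assms unfolding sum_distrib_left
    by (intro sum.cong) (auto simp: orthogonal_idempotents_def)
  then show "x * \<Sum>E = x" using assms by simp
  have "\<Sum>E * x = (\<Sum>y\<in>E. if y = x then x else 0)"
    using assms unfolding sum_distrib_right
    by (intro sum.cong) (auto simp: orthogonal_idempotents_def)
  then show "\<Sum>E * x = x" using assms by simp
qed

lemma primitive_decomposition:
  fixes e :: "'a::ring_1"
  assumes fin: "finite (UNIV :: 'a set)" and "e * e = e"
  shows "\<exists>E. finite E \<and> (\<forall>x\<in>E. primitive_idempotent x) \<and> orthogonal_idempotents E \<and> \<Sum>E = e"
  using \<open>e * e = e\<close>
proof (induction "card (range (\<lambda>x. x * e))" arbitrary: e rule: less_induct)
  case less
  have fin': "finite A" for A :: "'a set" by (rule rev_finite_subset[OF fin subset_UNIV])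
  consider "e = 0" | "primitive_idempotent e"
    | f g where "f * f = f" "g * g = g" "f * g = 0" "g * f = 0" "e = f + g" "f \<noteq> 0" "g \<noteq> 0"
    using less.prems unfolding primitive_idempotent_def by metis
  then show ?case
  proof cases
    case 1
    then show ?thesis by (intro exI[of _ "{}"]) (auto simp: orthogonal_idempotents_def)
  next
    case 2
    then show ?thesis
      using less.prems by (intro exI[of _ "{e}"]) (auto simp: orthogonal_idempotents_def)
  next
    case (3 f g)
    have smaller: "card (range (\<lambda>x. x * f)) < card (range (\<lambda>x. x * e))"
      if "f * f = f" "g * g = g" "f * g = 0" "g * f = 0" "e = f + g" "g \<noteq> 0" for f g
    proof (rule psubset_card_mono[OF fin'])
      have "f * e = f" "g * e = g" using that(1-5) by (simp_all add: distrib_left)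
      then have "x * f = (x * f) * e" "g = g * e" for x by (simp_all add: mult.assoc)
      then have "x * f \<in> range (\<lambda>x. x * e)" "g \<in> range (\<lambda>x. x * e)" for x by blast+
      moreover have "g \<notin> range (\<lambda>x. x * f)"
      proof
        assume "g \<in> range (\<lambda>x. x * f)"
        then obtain x where "g = x * f" by blast
        then have "g * f = g" using that(1) by (simp add: mult.assoc)
        then show False using that(4,6) by simp
      qed
      ultimately show "range (\<lambda>x. x * f) \<subset> range (\<lambda>x. x * e)" by blast
    qed
    obtain F where F: "finite F" "\<forall>x\<in>F. primitive_idempotent x" "orthogonal_idempotents F" "\<Sum>F = f"
      using less.hyps[OF smaller[of f g]] 3 by blast
    obtain G where G: "finite G" "\<forall>x\<in>G. primitive_idempotent x" "orthogonal_idempotents G" "\<Sum>G = g"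
      using less.hyps[OF smaller[of g f]] 3 by (auto simp: add.commute)
    have FG: "x * y = 0" "y * x = 0" if "x \<in> F" "y \<in> G" for x y
    proof -
      have x: "x * f = x" "f * x = x" and y: "y * g = y" "g * y = y"
        using orthogonal_idempotents_sum F G that by metis+
      show "x * y = 0" by (metis x(1) y(2) 3(3) mult.assoc mult_zero_left mult_zero_right)
      show "y * x = 0" by (metis x(2) y(1) 3(4) mult.assoc mult_zero_left mult_zero_right)
    qed
    have "F \<inter> G = {}"
      using FG(1) F(2) unfolding primitive_idempotent_def by (metis disjoint_iff)
    moreover have "orthogonal_idempotents (F \<union> G)"
      using F(3) G(3) FG unfolding orthogonal_idempotents_def by (metis Un_iff)
    ultimately show ?thesis using F G 3(5)
      by (intro exI[of _ "F \<union> G"]) (auto simp: sum.union_disjoint)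
  qed
qed

lemma primitive_idempotent_conjugate:
  fixes u v x :: "'a::ring_1"
  assumes uv: "u * v = 1" and vu: "v * u = 1" and x: "primitive_idempotent x"
  shows "primitive_idempotent (v * x * u)"
proof -
  have uva: "u * (v * a) = a" and vua: "v * (u * a) = a" for a
    using uv vu by (simp_all flip: mult.assoc)
  have zero: "f = 0" if "u * f * v = 0" for f
  proof -
    have "f = v * (u * f * v) * u" by (simp add: mult.assoc vua vu)
    then show ?thesis using that by simp
  qed
  have xx: "x * (x * a) = x * a" for a
    using x by (simp add: primitive_idempotent_def flip: mult.assoc)
  show ?thesis
    unfolding primitive_idempotent_def
  proof (intro conjI allI impI)
    show "v * x * u * (v * x * u) = v * x * u"
      by (simp add: mult.assoc uva xx)
    have "u * (v * x * u) * v = x" by (simp add: mult.assoc uva uv)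
    then show "v * x * u \<noteq> 0" using x by (auto simp: primitive_idempotent_def)
    fix f g
    assume fg: "f * f = f \<and> g * g = g \<and> f * g = 0 \<and> g * f = 0 \<and> v * x * u = f + g"
    have conj: "(u * a * v) * (u * b * v) = u * (a * b) * v" for a b
      by (simp add: mult.assoc vua)
    have "x = u * (v * x * u) * v" by (simp add: mult.assoc uva uv)
    then have "x = u * f * v + u * g * v" using fg by (simp only: distrib_left distrib_right)
    then have "u * f * v = 0 \<or> u * g * v = 0"
      using x fg conj[of f f] conj[of g g] conj[of f g] conj[of g f]
      unfolding primitive_idempotent_def by simp
    then show "f = 0 \<or> g = 0" using zero by blast
  qed
qed

locale nilpotent_central =
  fixes c :: "'a::ring_1" and n :: nat
  assumes central: "\<And>x. c * x = x * c" and nilpotent: "c ^ n = 0"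
    and finite_type: "finite (UNIV :: 'a set)"
begin

definition J :: "'a set" where "J = range ((*) c)"

lemma central_power: "c ^ k * x = x * c ^ k"
  using power_commuting_commutes[of c x k] central by simp

lemma left_ideal_J: "left_ideal J"
  unfolding left_ideal_def J_def
proof (intro conjI ballI allI)
  show "0 \<in> range ((*) c)" by (metis mult_zero_right rangeI)
  fix x assume x: "x \<in> range ((*) c)"
  show "x + y \<in> range ((*) c)" if "y \<in> range ((*) c)" for y
    using x that by (auto simp flip: distrib_left)
  show "a * x \<in> range ((*) c)" for a
    using x by (metis (no_types, lifting) central imageE mult.assoc rangeI)
qed

lemma J_closed:
  "0 \<in> J" "x \<in> J \<Longrightarrow> y \<in> J \<Longrightarrow> x + y \<in> J" "x \<in> J \<Longrightarrow> a * x \<in> J" "x \<in> J \<Longrightarrow> x * a \<in> J"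
  "x \<in> J \<Longrightarrow> - x \<in> J" "x \<in> J \<Longrightarrow> y \<in> J \<Longrightarrow> x - y \<in> J"
proof -
  show "x \<in> J \<Longrightarrow> x * a \<in> J" by (auto simp: J_def mult.assoc)
  show "x \<in> J \<Longrightarrow> y \<in> J \<Longrightarrow> x - y \<in> J"
    using left_ideal_J left_ideal_uminus[of J y] unfolding left_ideal_def
    by (metis add_uminus_conv_diff)
qed (use left_ideal_J left_ideal_uminus[of J] in \<open>auto simp: left_ideal_def\<close>)

lemma unit_if_cong_1:
  assumes "u - 1 \<in> J"
  obtains v where "u * v = 1" "v * u = 1"
proof -
  obtain m where m: "m > 0" "u ^ m * u ^ m = u ^ m"
    using finite_idempotent_power[OF finite_type] .
  have "u ^ k - 1 \<in> J" for k
  proof (induction k)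
    case (Suc k)
    have "u ^ Suc k - 1 = u * (u ^ k - 1) + (u - 1)" by (simp add: algebra_simps)
    then show ?case using Suc assms J_closed by metis
  qed (simp add: J_closed)
  then have "1 - u ^ m \<in> J" using J_closed(5)[of "u ^ m - 1"] by simp
  then obtain b where b: "1 - u ^ m = c * b" by (auto simp: J_def)
  have square: "(1 - u ^ m) * (1 - u ^ m) = 1 - u ^ m" by (simp add: algebra_simps m)
  have idem: "(1 - u ^ m) ^ Suc k = 1 - u ^ m" for k
  proof (induction k)
    case (Suc k)
    then show ?case using square by (simp only: power_Suc)
  qed simp
  have "(c * b) ^ k = c ^ k * b ^ k" for k
  proof (induction k)
    case (Suc k)
    have "(c * b) ^ Suc k = c * (b * c ^ k) * b ^ k" using Suc by (simp add: mult.assoc)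
    also have "\<dots> = c * (c ^ k * b) * b ^ k" by (simp only: central_power)
    finally show ?case by (simp add: mult.assoc)
  qed simp
  then have "1 - u ^ m = c ^ Suc n * b ^ Suc n" using idem[of n] b by metis
  then have "u ^ m = 1" by (simp add: nilpotent)
  then have "u * u ^ (m - 1) = 1" "u ^ (m - 1) * u = 1"
    using m(1) by (metis power_minus_mult power_commutes)+
  then show thesis by (rule that)
qed

lemma nested_idempotents:
  fixes L :: "nat \<Rightarrow> 'a set"
  assumes ideal: "\<And>k. left_ideal (L k)" and J: "\<And>k. J \<subseteq> L k"
    and mono: "\<And>i j. i \<le> j \<Longrightarrow> L i \<subseteq> L j"
    and gen: "\<And>k. k < m \<Longrightarrow> \<exists>f\<in>L k. \<forall>x\<in>L k. x * f - x \<in> J"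
    and idem: "t * t = t" and t: "\<And>k x. k < m \<Longrightarrow> x \<in> L k \<Longrightarrow> x * t - x \<in> J"
  shows "\<exists>g. g 0 = 0 \<and> (\<forall>i\<le>m. \<forall>j\<le>m. g i * g j = g (min i j)) \<and>
    (\<forall>i\<le>m. t * g i = g i \<and> g i * t = g i) \<and>
    (\<forall>k<m. g (Suc k) \<in> L k \<and> (\<forall>x\<in>L k. x * g (Suc k) - x \<in> J))"
  using gen idem t
proof (induction m arbitrary: t)
  case 0
  then show ?case by (intro exI[of _ "\<lambda>_. 0"]) simp
next
  case (Suc m)
  obtain f where f: "f \<in> L m" "\<And>x. x \<in> L m \<Longrightarrow> x * f - x \<in> J"
    using Suc.prems(1) by blast
  have J_L: "x \<in> L m \<Longrightarrow> y \<in> J \<Longrightarrow> x + y \<in> L m" for x y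
    using ideal[of m] J[of m] unfolding left_ideal_def by blast
  have mult_L: "x \<in> L m \<Longrightarrow> a * x \<in> L m" for a x
    using ideal[of m] unfolding left_ideal_def by blast
  have trans: "x * (a * b) - x \<in> J" if "x * a - x \<in> J" "x * b - x \<in> J" for x a b
  proof -
    have "x * (a * b) - x = (x * a - x) * b + (x * b - x)" by (simp add: algebra_simps)
    then show ?thesis using that J_closed by metis
  qed
  define s where "s = t * f * t"
  have s_L: "s \<in> L m"
  proof -
    have "t * f \<in> L m" using f(1) mult_L by blast
    then have "t * f + (t * f * t - t * f) \<in> L m" using Suc.prems(3) J_L by blast
    then show ?thesis by (simp add: s_def)
  qed
  have s_cong: "x * s - x \<in> J" if "x \<in> L m" for x
    unfolding s_def using that f(2) Suc.prems(3)[of m x] by (intro trans) auto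
  obtain q where q: "q > 0" "s ^ q * s ^ q = s ^ q"
    using finite_idempotent_power[OF finite_type] .
  define h where "h = s ^ q"
  have h: "h * h = h" using q by (simp add: h_def)
  have h_L: "h \<in> L m"
    using mult_L[OF s_L, of "s ^ (q - 1)"] by (simp only: h_def power_minus_mult[OF q(1)])
  have h_cong: "x * h - x \<in> J" if "x \<in> L m" for x
  proof -
    have "x * s ^ j - x \<in> J" for j
      by (induction j) (use s_cong[OF that] trans in \<open>auto simp: J_closed\<close>)
    then show ?thesis by (simp add: h_def)
  qed
  have ts: "t * s = s" "s * t = s"
    using Suc.prems(2) by (simp_all add: s_def mult.assoc) (simp flip: mult.assoc)
  have th: "t * h = h" "h * t = h"
  proof -
    obtain q' where "q = Suc q'" using q(1) by (cases q) auto
    then have "h = s * s ^ q'" "h = s ^ q' * s" by (simp_all add: h_def power_commutes)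
    then show "t * h = h" "h * t = h" using ts by (metis mult.assoc)+
  qed
  obtain g where g: "g 0 = 0" "\<And>i j. i \<le> m \<Longrightarrow> j \<le> m \<Longrightarrow> g i * g j = g (min i j)"
    "\<And>i. i \<le> m \<Longrightarrow> h * g i = g i" "\<And>i. i \<le> m \<Longrightarrow> g i * h = g i"
    "\<And>k. k < m \<Longrightarrow> g (Suc k) \<in> L k" "\<And>k x. k < m \<Longrightarrow> x \<in> L k \<Longrightarrow> x * g (Suc k) - x \<in> J"
  proof -
    have "x * h - x \<in> J" if "k < m" "x \<in> L k" for k x
      using h_cong mono[of k m] that by auto
    from Suc.IH[OF Suc.prems(1) h this] show thesis using that by fastforce
  qed
  have tg: "t * g i = g i" "g i * t = g i" if "i \<le> m" for i
    using g(3,4)[OF that] th by (metis mult.assoc)+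
  show ?case
  proof (intro exI[of _ "g(Suc m := h)"] conjI allI impI)
    fix i j assume "i \<le> Suc m" "j \<le> Suc m"
    then show "(g(Suc m := h)) i * (g(Suc m := h)) j = (g(Suc m := h)) (min i j)"
      using g(2,3,4) h by (auto simp: le_Suc_eq min_def)
  qed (use g th tg h_L h_cong in \<open>auto simp: le_Suc_eq less_Suc_eq\<close>)
qed

text \<open>The full preimage in the ring of a left ideal of the quotient by \<open>J\<close>.\<close>

definition layer :: "'a set \<Rightarrow> nat \<Rightarrow> 'a set" where
  "layer C k = {x + j | x j. c ^ k * x \<in> C \<and> j \<in> J}"

lemma mem_layer: "c ^ k * x \<in> C \<Longrightarrow> x \<in> layer C k"
  using J_closed(1) unfolding layer_def by (metis (mono_tags, lifting) add.right_neutral mem_Collect_eq)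

lemma J_subset_layer:
  assumes "left_ideal C"
  shows "J \<subseteq> layer C k"
proof -
  have "c ^ k * 0 \<in> C" using assms by (simp add: left_ideal_def)
  then show ?thesis
    unfolding layer_def by (metis (mono_tags, lifting) add.left_neutral mem_Collect_eq subsetI)
qed

lemma left_ideal_layer:
  assumes C: "left_ideal C"
  shows "left_ideal (layer C k)"
  unfolding left_ideal_def
proof (intro conjI ballI allI)
  have C_closed: "x \<in> C \<Longrightarrow> y \<in> C \<Longrightarrow> x + y \<in> C" "x \<in> C \<Longrightarrow> b * x \<in> C" for x y b
    using C by (auto simp: left_ideal_def)
  show "0 \<in> layer C k" using J_subset_layer[OF C] J_closed(1) by blast
  fix x assume "x \<in> layer C k"
  then obtain x1 x2 where x: "x = x1 + x2" "c ^ k * x1 \<in> C" "x2 \<in> J" by (auto simp: layer_def)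
  {
    fix y assume "y \<in> layer C k"
    then obtain y1 y2 where y: "y = y1 + y2" "c ^ k * y1 \<in> C" "y2 \<in> J" by (auto simp: layer_def)
    have "x + y = (x1 + y1) + (x2 + y2)" using x y by (simp add: algebra_simps)
    moreover have "c ^ k * (x1 + y1) \<in> C" using x y C_closed by (simp add: distrib_left)
    moreover have "x2 + y2 \<in> J" using x y J_closed by blast
    ultimately show "x + y \<in> layer C k" unfolding layer_def by blast
  }
  fix b
  have "c ^ k * (b * x1) \<in> C"
    using C_closed(2)[OF x(2), of b] by (metis central_power mult.assoc)
  moreover have "b * x = b * x1 + b * x2" using x by (simp add: distrib_left)
  moreover have "b * x2 \<in> J" using x J_closed by blast
  ultimately show "b * x \<in> layer C k" unfolding layer_def by blast
qed

lemma direct_sum_of_primitive_idempotents: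
  assumes C: "left_ideal C"
    and gen: "\<And>k. k < n \<Longrightarrow> \<exists>f. c ^ k * f \<in> C \<and> (\<forall>x. c ^ k * x \<in> C \<longrightarrow> x * f - x \<in> J)"
  obtains E a where "finite E" "\<And>x. x \<in> E \<Longrightarrow> primitive_idempotent x" "orthogonal_idempotents E"
    "\<And>x y. x \<in> E \<Longrightarrow> c ^ a x * y * x \<in> C"
    "\<And>x z. x \<in> E \<Longrightarrow> z \<in> C \<Longrightarrow> \<exists>y. z * x = c ^ a x * y * x"
    "\<And>z. z \<in> C \<Longrightarrow> z * \<Sum>E = z"
proof -
  have C_closed: "0 \<in> C" "x \<in> C \<Longrightarrow> y \<in> C \<Longrightarrow> x + y \<in> C" "x \<in> C \<Longrightarrow> b * x \<in> C" for x y b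
    using C by (auto simp: left_ideal_def)
  define L where "L = layer C"
  have L_D: "x \<in> L k" if "c ^ k * x \<in> C" for x k
    using that unfolding L_def by (rule mem_layer)
  have L_J: "J \<subseteq> L k" for k
    unfolding L_def by (rule J_subset_layer[OF C])
  have L_ideal: "left_ideal (L k)" for k
    unfolding L_def by (rule left_ideal_layer[OF C])
  have L_mono: "L i \<subseteq> L j" if "i \<le> j" for i j
  proof -
    have "c ^ j * x \<in> C" if "c ^ i * x \<in> C" for x
      using C_closed(3)[OF that, of "c ^ (j - i)"] \<open>i \<le> j\<close> by (simp flip: mult.assoc power_add)
    then show ?thesis unfolding L_def layer_def by blast
  qed
  have L_gen: "\<exists>f\<in>L k. \<forall>x\<in>L k. x * f - x \<in> J" if k: "k < n" for k
  proof -
    obtain f where f: "c ^ k * f \<in> C" "\<And>x. c ^ k * x \<in> C \<Longrightarrow> x * f - x \<in> J"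
      using gen[OF k] by blast
    have "(x + j) * f - (x + j) \<in> J" if "c ^ k * x \<in> C" "j \<in> J" for x j
    proof -
      have "(x + j) * f - (x + j) = (x * f - x) + (j * f - j)" by (simp add: algebra_simps)
      then show ?thesis using f that J_closed by metis
    qed
    then show ?thesis using L_D[OF f(1)] by (auto simp: L_def layer_def intro!: bexI[of _ f])
  qed
  obtain g where g0: "g 0 = 0"
    and gg: "\<And>i j. i \<le> n \<Longrightarrow> j \<le> n \<Longrightarrow> g i * g j = g (min i j)"
    and g_L: "\<And>k. k < n \<Longrightarrow> g (Suc k) \<in> L k"
    and g_cong: "\<And>k x. k < n \<Longrightarrow> x \<in> L k \<Longrightarrow> x * g (Suc k) - x \<in> J"
    using nested_idempotents[of L n 1, OF L_ideal L_J L_mono L_gen] J_closed(1) by auto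
  define e where "e k = g (Suc k) - g k" for k
  have sum_e: "(\<Sum>k<j. e k) = g j" for j
    unfolding e_def by (subst sum_lessThan_telescope) (simp add: g0)
  have ee: "e i * e j = (if i = j then e i else 0)" if "i < n" "j < n" for i j
  proof (cases i j rule: linorder_cases)
    case greater
    then have "min i (Suc j) = Suc j" by simp
    then show ?thesis using greater that by (simp add: e_def algebra_simps gg)
  qed (use that in \<open>auto simp: e_def algebra_simps gg min_def\<close>)
  have ge: "g i * e k = (if k < i then e k else 0)" "e k * g i = (if k < i then e k else 0)"
    if "i \<le> n" "k < n" for i k
    using that by (auto simp: e_def algebra_simps gg min_def le_Suc_eq)
  have "\<exists>x. c ^ k * x \<in> C \<and> x - e k \<in> J" if k: "k < n" for k
  proof -
    have "g k \<in> L k"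
    proof (cases k)
      case 0
      then show ?thesis using g0 L_ideal by (simp add: left_ideal_def)
    next
      case (Suc k')
      then show ?thesis using g_L[of k'] L_mono[of k' k] k by auto
    qed
    then have "e k \<in> L k"
      using g_L[OF k] L_ideal[of k] left_ideal_uminus[of "L k" "g k"]
      unfolding e_def left_ideal_def by (metis add_uminus_conv_diff)
    then obtain x j where xj: "e k = x + j" "c ^ k * x \<in> C" "j \<in> J" by (auto simp: L_def layer_def)
    then have "x - e k \<in> J" using J_closed(5)[OF xj(3)] by simp
    then show ?thesis using xj by blast
  qed
  then obtain w where w_C: "\<And>k. k < n \<Longrightarrow> c ^ k * w k \<in> C" and w_e: "\<And>k. k < n \<Longrightarrow> w k - e k \<in> J"
    by metis
  text \<open>This choice makes \<open>e k * u = e k * w k\<close>.\<close>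
  define u where "u = 1 + (\<Sum>k<n. e k * (w k - e k))"
  have "u - 1 \<in> J"
    unfolding u_def using w_e by (auto intro!: left_ideal_sum[OF left_ideal_J] J_closed(3))
  then obtain v where uv: "u * v = 1" and vu: "v * u = 1" by (rule unit_if_cong_1)
  have eu: "e k * u = e k * w k" if k: "k < n" for k
  proof -
    have "e k * u = e k + (\<Sum>i<n. e k * e i * (w i - e i))"
      by (simp add: u_def distrib_left sum_distrib_left mult.assoc)
    also have "(\<Sum>i<n. e k * e i * (w i - e i)) = (\<Sum>i<n. if i = k then e k * (w k - e k) else 0)"
      using k by (intro sum.cong) (auto simp: ee)
    also have "\<dots> = e k * w k - e k" using k ee[OF k k] by (simp add: right_diff_distrib)
    finally show ?thesis by simp
  qed
  have eu_C: "c ^ k * b * (e k * u) \<in> C" if "k < n" for k b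
  proof -
    have "c ^ k * b * (e k * u) = (b * e k) * (c ^ k * w k)"
      by (metis central_power eu mult.assoc that)
    then show ?thesis using C_closed(3) w_C that by metis
  qed
  define S where "S = {z. z * g n = z \<and> (\<forall>k<n. \<exists>y. z * e k = c ^ k * y)}"
  have S_add: "z + z' \<in> S" if "z \<in> S" "z' \<in> S" for z z'
    using that unfolding S_def by (auto simp: distrib_right) (metis distrib_left)
  have CS: "z * v \<in> S" if "z \<in> C" "z = c ^ (n - d) * y" "d \<le> n" for z d y
    using that
  proof (induction d arbitrary: z y)
    case 0
    then show ?case using exI[of "\<lambda>y. 0 = c ^ k * y" 0 for k] by (simp add: nilpotent S_def)
  next
    case (Suc d)
    define j where "j = n - Suc d"
    have j: "j < n" "n - d = Suc j" using Suc.prems(3) by (auto simp: j_def)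
    define z1 where "z1 = c ^ j * y * g (Suc j)"
    have z1_C: "z1 * u \<in> C"
    proof -
      have "z1 * u = (\<Sum>k<Suc j. c ^ j * y * (e k * u))"
        unfolding z1_def sum_e[symmetric] by (simp add: sum_distrib_left sum_distrib_right mult.assoc del: sum.lessThan_Suc)
      moreover have "c ^ j * y * (e k * u) \<in> C" if "k < Suc j" for k
      proof -
        have "c ^ j = c ^ k * c ^ (j - k)" using that by (simp flip: power_add)
        then show ?thesis using eu_C[of k "c ^ (j - k) * y"] that j by (simp add: mult.assoc)
      qed
      ultimately show ?thesis using left_ideal_sum[OF C] by (metis lessThan_iff)
    qed
    have z1_S: "z1 \<in> S"
      unfolding S_def
    proof (intro CollectI conjI allI impI)
      show "z1 * g n = z1" using j by (simp add: z1_def mult.assoc gg)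
      fix k assume k: "k < n"
      show "\<exists>x. z1 * e k = c ^ k * x"
      proof (cases "k < Suc j")
        case True
        then have "c ^ j = c ^ k * c ^ (j - k)" by (simp flip: power_add)
        then show ?thesis using True j k
          by (intro exI[of _ "c ^ (j - k) * (y * e k)"]) (simp add: z1_def mult.assoc ge)
      next
        case False
        then show ?thesis using j k by (intro exI[of _ 0]) (simp add: z1_def mult.assoc ge)
      qed
    qed
    have "y - y * g (Suc j) * u \<in> J"
    proof -
      have "y - y * g (Suc j) * u = - (y * g (Suc j) - y) - y * g (Suc j) * (u - 1)"
        by (simp add: algebra_simps)
      moreover have "y * g (Suc j) - y \<in> J"
        using g_cong j L_D Suc.prems(1,2) by (simp add: j_def)
      ultimately show ?thesis using \<open>u - 1 \<in> J\<close> J_closed by metis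
    qed
    then obtain b where b: "y - y * g (Suc j) * u = c * b" by (auto simp: J_def)
    have z: "z - z1 * u = c ^ (n - d) * b"
    proof -
      have "z - z1 * u = c ^ j * (y - y * g (Suc j) * u)"
        using Suc.prems(2) by (simp add: z1_def j_def right_diff_distrib mult.assoc)
      then show ?thesis by (simp add: b j(2) power_commutes flip: mult.assoc)
    qed
    have "z - z1 * u \<in> C"
      using C_closed(2)[OF Suc.prems(1) left_ideal_uminus[OF C z1_C]] by simp
    then have "(z - z1 * u) * v \<in> S" using Suc.IH z Suc.prems(3) by simp
    then have "(z - z1 * u) * v + z1 \<in> S" using S_add z1_S by blast
    then show ?case using uv by (simp add: left_diff_distrib mult.assoc)
  qed
  then have CS: "z * v \<in> S" if "z \<in> C" for z
    using CS[OF that, of n z] by simp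
  have "\<forall>k<n. \<exists>E. finite E \<and> (\<forall>x\<in>E. primitive_idempotent x) \<and> orthogonal_idempotents E \<and> \<Sum>E = e k"
    using primitive_decomposition[OF finite_type] ee by simp
  then obtain P where P: "\<And>k. k < n \<Longrightarrow> finite (P k)"
    "\<And>k x. k < n \<Longrightarrow> x \<in> P k \<Longrightarrow> primitive_idempotent x"
    "\<And>k. k < n \<Longrightarrow> orthogonal_idempotents (P k)" "\<And>k. k < n \<Longrightarrow> \<Sum>(P k) = e k"
    by metis
  have Pe: "x * e k = x" "e k * x = x" if "k < n" "x \<in> P k" for k x
    using orthogonal_idempotents_sum[OF P(3,1)] P(4) that by metis+
  have PP: "x * y = 0" if "i < n" "j < n" "i \<noteq> j" "x \<in> P i" "y \<in> P j" for i j x y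
  proof -
    have "x * y = x * (e i * e j) * y" using Pe that by (metis mult.assoc)
    then show ?thesis using ee that by simp
  qed
  define B where "B = (\<Union>k<n. P k)"
  define b where "b x = (SOME k. k < n \<and> x \<in> P k)" for x
  have b: "b x < n" "x \<in> P (b x)" if "x \<in> B" for x
    using someI_ex[of "\<lambda>k. k < n \<and> x \<in> P k"] that by (auto simp: B_def b_def)
  have B_ortho: "orthogonal_idempotents B"
    unfolding orthogonal_idempotents_def
  proof (intro conjI ballI impI)
    show "x * x = x" if "x \<in> B" for x
      using P(3) b[OF that] unfolding orthogonal_idempotents_def by blast
    show "x * y = 0" if "x \<in> B" "y \<in> B" "x \<noteq> y" for x y
      using P(3) b[OF that(1)] b[OF that(2)] PP that(3) unfolding orthogonal_idempotents_def by metis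
  qed
  have "P i \<inter> P j = {}" if "i < n" "j < n" "i \<noteq> j" for i j
    using PP[OF that] P(2) that unfolding primitive_idempotent_def by (metis disjoint_iff)
  then have sum_B: "\<Sum>B = g n"
    unfolding B_def by (subst sum.UNION_disjoint) (auto simp: P sum_e)
  define E where "E = (\<lambda>x. v * x * u) ` B"
  have uva: "u * (v * z) = z" for z
    using uv by (simp flip: mult.assoc)
  have conj: "u * (v * x * u) * v = x" for x by (simp add: mult.assoc uva uv)
  have inj: "inj_on (\<lambda>x. v * x * u) B" by (rule inj_onI) (metis conj)
  show thesis
  proof (rule that[of E "\<lambda>y. b (u * y * v)"])
    show "finite E" using P(1) by (simp add: E_def B_def)
    show "primitive_idempotent y" if y: "y \<in> E" for y
    proof -
      obtain x where "x \<in> B" "y = v * x * u" using y by (auto simp: E_def)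
      then show ?thesis using primitive_idempotent_conjugate[OF uv vu] P(2) b by blast
    qed
    have "(v * x * u) * (v * y * u) = v * (x * y) * u" for x y
      by (simp add: mult.assoc uva)
    moreover have "x * y = (if x = y then x else 0)" if "x \<in> B" "y \<in> B" for x y
      using B_ortho that by (simp add: orthogonal_idempotents_def)
    ultimately show "orthogonal_idempotents E"
      unfolding orthogonal_idempotents_def E_def by auto
    show "c ^ b (u * y * v) * d * y \<in> C" if y: "y \<in> E" for y d
    proof -
      obtain x where x: "x \<in> B" "y = v * x * u" using y by (auto simp: E_def)
      then have "y = v * x * (e (b x) * u)" using Pe(1) b by (metis mult.assoc)
      then have "c ^ b x * d * y = c ^ b x * (d * v * x) * (e (b x) * u)" by (simp add: mult.assoc)
      then show ?thesis using eu_C b x conj by metis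
    qed
    show "\<exists>d. z * y = c ^ b (u * y * v) * d * y" if y: "y \<in> E" and z: "z \<in> C" for y z
    proof -
      obtain x where x: "x \<in> B" "y = v * x * u" using y by (auto simp: E_def)
      obtain d where d: "z * v * e (b x) = c ^ b x * d"
        using CS[OF z] b x unfolding S_def by blast
      have "z * y = z * v * (e (b x) * x) * u"
        using Pe(2) b x by (simp add: mult.assoc)
      also have "\<dots> = (z * v * e (b x)) * x * u" by (simp add: mult.assoc)
      also have "\<dots> = c ^ b x * (d * u) * y" unfolding d x by (simp add: mult.assoc uva)
      finally show ?thesis using x conj by metis
    qed
    show "z * \<Sum>E = z" if "z \<in> C" for z
    proof -
      have "\<Sum>E = v * g n * u"
        unfolding E_def sum.reindex[OF inj] sum_B[symmetric] o_def
        by (simp add: sum_distrib_left sum_distrib_right)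
      then have "z * \<Sum>E = (z * v * g n) * u" by (simp add: mult.assoc)
      also have "z * v * g n = z * v" using CS[OF that] by (simp add: S_def)
      finally show ?thesis by (simp add: mult.assoc vu)
    qed
  qed
qed

end

lemma left_ideal_principal: "left_ideal (range ((*) (x :: 'r::comm_ring_1)))"
  unfolding left_ideal_def
proof (intro conjI ballI allI)
  show "0 \<in> range ((*) x)" by (metis mult_zero_right rangeI)
  fix y assume y: "y \<in> range ((*) x)"
  show "y + z \<in> range ((*) x)" if "z \<in> range ((*) x)" for z
    using y that by (auto simp flip: distrib_left)
  show "b * y \<in> range ((*) x)" for b
    using y by (metis (no_types, lifting) imageE mult.left_commute rangeI)
qed

locale chain_ring_uniformizer =
  fixes \<pi> :: "'r::comm_ring_1" and n :: nat
  assumes uniformizer_power: "\<pi> ^ n = 0"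
    and annihilator: "\<And>j r. j \<le> n \<Longrightarrow> \<pi> ^ j * r = 0 \<Longrightarrow> \<pi> ^ (n - j) dvd r"
    and unit: "\<And>r. \<not> \<pi> dvd r \<Longrightarrow> r dvd 1"
    and finite_ring: "finite (UNIV :: 'r set)"

lemma artinian_chain_ring_uniformizer:
  fixes \<pi> :: "'r::comm_ring_1"
  assumes "artinian_ring TYPE('r)" and "chain_ring TYPE('r)"
    and "maximal_ideal \<mm>" and \<mm>: "\<mm> = range (\<lambda>r. \<pi> * r)"
    and "finite (residue_classes \<mm>)"
  obtains n where "chain_ring_uniformizer \<pi> n"
proof -
  have mem: "r \<in> \<mm> \<longleftrightarrow> \<pi> dvd r" for r by (auto simp: \<mm> dvd_def)
  have unit: "r dvd 1" if "\<not> \<pi> dvd r" for r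
  proof -
    have "r \<in> range ((*) r)" by (metis mult.right_neutral rangeI)
    then have "\<not> range ((*) r) \<subseteq> \<mm>" using that mem by blast
    then have "\<mm> \<subseteq> range ((*) r)" "\<mm> \<noteq> range ((*) r)"
      using assms(2) left_ideal_principal[of r] left_ideal_principal[of \<pi>]
      unfolding chain_ring_def \<mm> by blast+
    then have "range ((*) r) = UNIV"
      using assms(3) left_ideal_principal[of r] unfolding maximal_ideal_def by metis
    then show ?thesis by (metis UNIV_I dvd_triv_left imageE)
  qed
  have "\<exists>k. \<pi> ^ k = 0"
  proof -
    have "left_ideal (range ((*) (\<pi> ^ k))) \<and> range ((*) (\<pi> ^ Suc k)) \<subseteq> range ((*) (\<pi> ^ k))" for k
      using left_ideal_principal by (auto simp: mult.assoc mult.left_commute[of \<pi>])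
    then obtain k where "\<forall>i\<ge>k. range ((*) (\<pi> ^ i)) = range ((*) (\<pi> ^ k))"
      using assms(1)[unfolded artinian_ring_def, rule_format, of "\<lambda>k. range ((*) (\<pi> ^ k))"] by blast
    then have "range ((*) (\<pi> ^ Suc k)) = range ((*) (\<pi> ^ k))"
      using le_SucI[OF order_refl] by blast
    moreover have "\<pi> ^ k \<in> range ((*) (\<pi> ^ k))" by (rule range_eqI[of _ _ 1]) simp
    ultimately obtain r where r: "\<pi> ^ k = \<pi> ^ Suc k * r" by blast
    have "\<not> \<pi> dvd 1 - \<pi> * r"
    proof
      assume "\<pi> dvd 1 - \<pi> * r"
      then have "\<pi> dvd 1" by (metis dvd_triv_left diff_add_cancel dvd_add)
      then have "\<mm> = UNIV" using mem dvd_trans one_dvd by (metis UNIV_eq_I)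
      then show False using assms(3) by (simp add: maximal_ideal_def)
    qed
    then obtain s where s: "1 = (1 - \<pi> * r) * s" using unit dvdE by blast
    have "\<pi> ^ k * (1 - \<pi> * r) = 0" using r by (simp add: algebra_simps)
    then have "\<pi> ^ k * ((1 - \<pi> * r) * s) = 0" by (simp flip: mult.assoc)
    then show ?thesis using s by auto
  qed
  define n where "n = (LEAST k. \<pi> ^ k = 0)"
  have n: "\<pi> ^ n = 0" and n_le: "\<And>k. \<pi> ^ k = 0 \<Longrightarrow> n \<le> k"
    using LeastI_ex[OF \<open>\<exists>k. \<pi> ^ k = 0\<close>] Least_le[of "\<lambda>k. \<pi> ^ k = 0"] by (auto simp: n_def)
  have ann: "\<pi> ^ (n - j) dvd r" if "\<pi> ^ j * r = 0" for j r
  proof (cases "r = 0")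
    case False
    have bound: "k \<le> n" if "\<pi> ^ k dvd r" for k
    proof (rule ccontr)
      assume "\<not> k \<le> n"
      then have "\<pi> ^ k = 0" using n by (metis le_add_diff_inverse mult_zero_left nat_le_linear power_add)
      then show False using False that by simp
    qed
    define i where "i = (GREATEST k. \<pi> ^ k dvd r)"
    have i: "\<pi> ^ i dvd r" and i_max: "\<And>k. \<pi> ^ k dvd r \<Longrightarrow> k \<le> i"
      unfolding i_def using GreatestI_nat[of "\<lambda>k. \<pi> ^ k dvd r" 0] Greatest_le_nat[of "\<lambda>k. \<pi> ^ k dvd r"] bound
      by auto
    obtain t where t: "r = \<pi> ^ i * t" using i by (elim dvdE)
    have "\<not> \<pi> dvd t"
    proof
      assume "\<pi> dvd t"
      then have "\<pi> ^ Suc i dvd r" unfolding t power_Suc2 by (rule mult_dvd_mono[OF dvd_refl])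
      then show False using i_max by fastforce
    qed
    then obtain s where s: "1 = t * s" using unit dvdE by blast
    have "\<pi> ^ (j + i) = \<pi> ^ j * r * s" by (simp add: t power_add mult.assoc s[symmetric])
    then have "n - j \<le> i" using n_le[of "j + i"] that by simp
    then show ?thesis using i le_imp_power_dvd dvd_trans by blast
  qed simp
  have "finite (UNIV :: 'r set)"
  proof -
    define S where "S = (\<lambda>X. SOME x :: 'r. x \<in> X) ` residue_classes \<mm>"
    have S_fin: "finite S" using assms(5) by (simp add: S_def)
    have S: "\<exists>x\<in>S. \<pi> dvd r - x" for r
    proof -
      define X where "X = {(x, y). x - y \<in> \<mm>} `` {r}"
      have "X \<in> residue_classes \<mm>" by (auto simp: X_def residue_classes_def quotient_def)
      moreover have "r \<in> X" by (simp add: X_def mem)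
      then have "(SOME x. x \<in> X) \<in> X" by (rule someI)
      then have "\<pi> dvd r - (SOME x. x \<in> X)" by (simp add: X_def mem)
      ultimately show ?thesis unfolding S_def by blast
    qed
    have "finite (range ((*) (\<pi> ^ (n - d))))" if "d \<le> n" for d
      using that
    proof (induction d)
      case 0
      have "range ((*) (\<pi> ^ n)) \<subseteq> {0}" using n by auto
      then show ?case using finite_subset by auto
    next
      case (Suc d)
      let ?k = "n - Suc d"
      have k: "n - d = Suc ?k" using Suc.prems by simp
      have "range ((*) (\<pi> ^ ?k)) \<subseteq> (\<lambda>(x, y). \<pi> ^ ?k * x + y) ` (S \<times> range ((*) (\<pi> ^ (n - d))))"
      proof safe
        fix r
        obtain x t where x: "x \<in> S" "r - x = \<pi> * t" using S[of r] by (auto elim: dvdE)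
        have "\<pi> ^ ?k * r = \<pi> ^ ?k * x + \<pi> ^ ?k * (r - x)" by (simp add: algebra_simps)
        also have "\<dots> = \<pi> ^ ?k * x + \<pi> ^ (n - d) * t" by (simp add: k x(2) mult.assoc mult.left_commute)
        finally show "\<pi> ^ ?k * r \<in> (\<lambda>(x, y). \<pi> ^ ?k * x + y) ` (S \<times> range ((*) (\<pi> ^ (n - d))))"
          using x(1) by (intro image_eqI[of _ _ "(x, \<pi> ^ (n - d) * t)"]) auto
      qed
      then show ?case using Suc S_fin by (meson Suc_leD finite_SigmaI finite_imageI finite_subset)
    qed
    from this[of n] show ?thesis by simp
  qed
  with n ann unit have "chain_ring_uniformizer \<pi> n" by unfold_locales
  then show thesis by (rule that)
qed

lemma lookup_scalar_times:
  fixes a :: "'g::{group_add,finite} \<Rightarrow>\<^sub>0 'r::comm_ring_1"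
  shows "Poly_Mapping.lookup (scalar r * a) g = r * Poly_Mapping.lookup a g"
  by (induction a rule: group_ring_induct)
    (simp_all add: mult_single lookup_single when_def distrib_left lookup_add)

lemma scalar_central:
  fixes a :: "'g::{group_add,finite} \<Rightarrow>\<^sub>0 'r::comm_ring_1"
  shows "scalar r * a = a * scalar r"
  by (induction a rule: group_ring_induct)
    (simp_all add: mult_single mult.commute distrib_left distrib_right)

lemma scalar_power: "scalar r ^ k = (scalar (r ^ k) :: 'g::group_add \<Rightarrow>\<^sub>0 'r::comm_ring_1)"
  by (induction k) (simp_all add: mult_single)

lemma finite_group_ring:
  assumes "finite (UNIV :: 'r::comm_ring_1 set)"
  shows "finite (UNIV :: ('g::{group_add,finite} \<Rightarrow>\<^sub>0 'r) set)"
proof -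
  have "finite (PiE (UNIV :: 'g set) (\<lambda>_. UNIV :: 'r set))" by (rule finite_PiE) (auto simp: assms)
  then have "finite (UNIV :: ('g \<Rightarrow> 'r) set)" by simp
  then have "finite (Poly_Mapping.lookup ` (UNIV :: ('g \<Rightarrow>\<^sub>0 'r) set))"
    using finite_subset subset_UNIV by blast
  then show ?thesis by (rule finite_imageD) (auto intro: inj_onI poly_mapping_eqI)
qed

lemma relative_projective_trace:
  fixes C :: "('g::{group_add,finite} \<Rightarrow>\<^sub>0 'r::comm_ring_1) set"
  assumes C: "left_ideal C" and rp: "relative_projective C"
  obtains \<theta> where "\<And>x. x \<in> C \<Longrightarrow> \<theta> x \<in> C"
    "\<And>x y. x \<in> C \<Longrightarrow> y \<in> C \<Longrightarrow> \<theta> (x + y) = \<theta> x + \<theta> y"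
    "\<And>r x. x \<in> C \<Longrightarrow> \<theta> (scalar r * x) = scalar r * \<theta> x"
    "\<And>x. x \<in> C \<Longrightarrow>
      (\<Sum>g\<in>UNIV. Poly_Mapping.single g 1 * \<theta> (Poly_Mapping.single (- g) 1 * x)) = x"
proof -
  let ?I = "ind_module C" and ?C = "ideal_module C"
  have CM: "left_module ?C" by (rule left_module_ideal[OF C])
  have IM: "left_module ?I" by (rule left_module_ind[OF C])
  interpret I: left_module ?I by (rule IM)
  have C0: "0 \<in> C" and Cmult: "\<And>a x. x \<in> C \<Longrightarrow> a * x \<in> C"
    using C by (auto simp: left_ideal_def)
  define \<phi> where "\<phi> F = (\<Sum>h\<in>UNIV. Poly_Mapping.single h 1 * F h)" for F :: "'g \<Rightarrow> 'g \<Rightarrow>\<^sub>0 'r"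
  define \<psi> where "\<psi> c = (\<lambda>h::'g. if h = 0 then c else 0)" for c :: "'g \<Rightarrow>\<^sub>0 'r"
  have \<phi>_C: "\<phi> F \<in> C" if "F \<in> carrier ?I" for F
    using that by (auto simp: \<phi>_def ind_module_def intro!: left_ideal_sum[OF C] Cmult)
  have \<phi>_add: "\<phi> (F \<oplus>\<^bsub>?I\<^esub> H) = \<phi> F + \<phi> H" for F H
    by (simp add: \<phi>_def ind_module_def algebra_simps sum.distrib)
  have \<phi>: "linear_over UNIV ?I ?C \<phi>"
  proof (rule linear_over_singleI[OF IM CM])
    fix g :: 'g and r :: 'r and F :: "'g \<Rightarrow> 'g \<Rightarrow>\<^sub>0 'r"
    have "\<phi> (Poly_Mapping.single g r \<odot>\<^bsub>?I\<^esub> F)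
        = (\<Sum>h\<in>UNIV. Poly_Mapping.single h r * F (- g + h))"
      by (simp add: \<phi>_def ind_smult_single mult_single flip: mult.assoc)
    also have "\<dots> = (\<Sum>k\<in>UNIV. Poly_Mapping.single (g + k) r * F k)"
      by (rule sum.reindex_bij_witness[of _ "\<lambda>k. g + k" "\<lambda>k. - g + k"])
        (auto simp flip: add.assoc)
    also have "\<dots> = Poly_Mapping.single g r * \<phi> F"
      by (simp add: \<phi>_def sum_distrib_left mult_single flip: mult.assoc)
    finally show "\<phi> (Poly_Mapping.single g r \<odot>\<^bsub>?I\<^esub> F) = Poly_Mapping.single g r \<odot>\<^bsub>?C\<^esub> \<phi> F"
      by (simp add: ideal_module_def)
  qed (use \<phi>_C \<phi>_add in \<open>auto simp: ideal_module_def\<close>)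
  have \<phi>_smult: "\<phi> (a \<odot>\<^bsub>?I\<^esub> F) = a * \<phi> F" if "F \<in> carrier ?I" for a F
    using \<phi> that by (auto simp: linear_over_def ideal_module_def)
  have \<psi>: "linear_over (range scalar) ?C ?I \<psi>"
    by (auto simp: linear_over_def ideal_module_def ind_smult_single \<psi>_def C0)
      (auto simp: ind_module_def C0)
  have \<phi>\<psi>: "\<phi> (\<psi> c) = c" for c
  proof -
    have "\<phi> (\<psi> c) = (\<Sum>h\<in>(UNIV::'g set). if h = 0 then c else 0)"
      unfolding \<phi>_def \<psi>_def by (rule sum.cong[OF refl]) simp
    then show ?thesis by simp
  qed
  define K where "K = ?I\<lparr>carrier := {F \<in> carrier ?I. \<phi> F = 0}\<rparr>"
  have \<phi>0: "\<phi> \<zero>\<^bsub>?I\<^esub> = 0" by (simp add: \<phi>_def ind_module_def)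
  have K: "left_module K"
  proof -
    have ag: "abelian_group K"
    proof (rule abelian_groupI)
      fix x assume x: "x \<in> carrier K"
      have "\<phi> (\<ominus>\<^bsub>?I\<^esub> x) = 0"
        using x \<phi>_add[of "\<ominus>\<^bsub>?I\<^esub> x" x] by (simp add: K_def I.l_neg \<phi>0)
      then show "\<exists>y\<in>carrier K. y \<oplus>\<^bsub>K\<^esub> x = \<zero>\<^bsub>K\<^esub>"
        using x by (intro bexI[of _ "\<ominus>\<^bsub>?I\<^esub> x"]) (auto simp: K_def I.l_neg)
    qed (auto simp: K_def \<phi>_add \<phi>0 I.a_ac)
    show ?thesis
      by (rule left_module.intro[OF ag], unfold_locales)
        (auto simp: K_def \<phi>_smult I.smult_l_distr I.smult_r_distr I.smult_assoc)
  qed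
  have "short_exact K ?I ?C (\<lambda>x. x) \<phi>"
    unfolding short_exact_def
  proof (intro conjI)
    show "linear_over UNIV K ?I (\<lambda>x. x)" by (auto simp: linear_over_def K_def)
    have "c \<in> \<phi> ` carrier ?I" if "c \<in> C" for c
      using \<psi> that \<phi>\<psi>[of c] by (intro image_eqI[of _ _ "\<psi> c"]) (auto simp: linear_over_def ideal_module_def)
    then show "\<phi> ` carrier ?I = carrier ?C" using \<phi>_C by (auto simp: ideal_module_def)
  qed (use \<phi> in \<open>auto simp: K_def ideal_module_def\<close>)
  then obtain \<sigma> where \<sigma>: "linear_over UNIV ?C ?I \<sigma>" and \<phi>\<sigma>: "\<And>c. c \<in> C \<Longrightarrow> \<phi> (\<sigma> c) = c"
    using rp K IM \<psi> \<phi>\<psi> unfolding relative_projective_def relative_projective_in_def by blast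
  have \<sigma>_smult: "\<sigma> (Poly_Mapping.single g r * x) h = scalar r * \<sigma> x (- g + h)" if "x \<in> C" for g r x h
  proof -
    have "\<sigma> (Poly_Mapping.single g r * x) = Poly_Mapping.single g r \<odot>\<^bsub>?I\<^esub> \<sigma> x"
      using \<sigma> that by (simp add: linear_over_def ideal_module_def)
    then show ?thesis by (simp add: ind_smult_single)
  qed
  show thesis
  proof (rule that[of "\<lambda>x. \<sigma> x 0"])
    show "\<sigma> x 0 \<in> C" if "x \<in> C" for x
      using \<sigma> that by (auto simp: linear_over_def ideal_module_def ind_module_def)
    show "\<sigma> (x + y) 0 = \<sigma> x 0 + \<sigma> y 0" if "x \<in> C" "y \<in> C" for x y
      using \<sigma> that by (simp add: linear_over_def ideal_module_def ind_module_def)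
    show "\<sigma> (scalar r * x) 0 = scalar r * \<sigma> x 0" if "x \<in> C" for r x
      using \<sigma>_smult[OF that] by simp
    show "(\<Sum>g\<in>UNIV. Poly_Mapping.single g 1 * \<sigma> (Poly_Mapping.single (- g) 1 * x) 0) = x"
      if "x \<in> C" for x
      using \<phi>\<sigma>[OF that] by (simp add: \<sigma>_smult[OF that] \<phi>_def)
  qed
qed

definition scalar_submodule :: "('g::{group_add,finite} \<Rightarrow>\<^sub>0 'r::comm_ring_1) set \<Rightarrow> bool" where
  "scalar_submodule V \<longleftrightarrow>
     0 \<in> V \<and> (\<forall>x\<in>V. \<forall>y\<in>V. x + y \<in> V) \<and> (\<forall>r. \<forall>x\<in>V. scalar r * x \<in> V)"

lemma scalar_submodule_diff:
  assumes "scalar_submodule V" "x \<in> V" "y \<in> V"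
  shows "x - y \<in> V"
proof -
  have "scalar (- 1) * y = - y" by (simp add: single_uminus)
  then have "- y \<in> V" using assms unfolding scalar_submodule_def by metis
  then show ?thesis using assms unfolding scalar_submodule_def by (metis add_uminus_conv_diff)
qed

lemma left_ideal_scalar_submodule: "left_ideal V \<Longrightarrow> scalar_submodule V"
  by (simp add: left_ideal_def scalar_submodule_def)

context chain_ring_uniformizer
begin

lemma nilpotent_central_uniformizer:
  "nilpotent_central (scalar \<pi> :: 'g::{group_add,finite} \<Rightarrow>\<^sub>0 'r) n"
  by unfold_locales
    (simp_all add: scalar_central scalar_power uniformizer_power finite_group_ring finite_ring)

lemma annihilator_group_ring:
  fixes x :: "'g::{group_add,finite} \<Rightarrow>\<^sub>0 'r"
  assumes "j \<le> n" "scalar \<pi> ^ j * x = 0"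
  obtains y where "x = scalar \<pi> ^ (n - j) * y"
proof -
  have "\<pi> ^ j * Poly_Mapping.lookup x g = 0" for g
    using assms(2) by (metis lookup_scalar_times lookup_zero scalar_power)
  then have "\<exists>s. Poly_Mapping.lookup x g = \<pi> ^ (n - j) * s" for g
    using annihilator[OF assms(1)] unfolding dvd_def by blast
  then obtain s where s: "\<And>g. Poly_Mapping.lookup x g = \<pi> ^ (n - j) * s g" by metis
  have "x = (\<Sum>g\<in>UNIV. scalar (\<pi> ^ (n - j)) * Poly_Mapping.single g (s g))"
    by (subst poly_mapping_sum_single) (simp add: s mult_single)
  also have "\<dots> = scalar \<pi> ^ (n - j) * (\<Sum>g\<in>UNIV. Poly_Mapping.single g (s g))"
    by (simp add: scalar_power sum_distrib_left)
  finally show thesis by (rule that)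
qed

text \<open>Modulo \<open>\<pi>\<close> this is the existence of a vector space complement.\<close>

lemma complement_mod_uniformizer:
  fixes L J :: "('g::{group_add,finite} \<Rightarrow>\<^sub>0 'r) set"
  assumes J: "J = range ((*) (scalar \<pi>))" and L: "scalar_submodule L" "J \<subseteq> L"
  obtains W where "scalar_submodule W" "J \<subseteq> W" "W \<inter> L \<subseteq> J"
    "\<And>x. \<exists>y\<in>L. x - y \<in> W"
proof -
  interpret nilpotent_central "scalar \<pi> :: 'g \<Rightarrow>\<^sub>0 'r" n by (rule nilpotent_central_uniformizer)
  have J_eq: "J = nilpotent_central.J (scalar \<pi>)" by (simp add: J J_def)
  define \<W> where "\<W> = {W. scalar_submodule W \<and> J \<subseteq> W \<and> W \<inter> L \<subseteq> J}"
  have "J \<in> \<W>"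
    using left_ideal_scalar_submodule[OF left_ideal_J] by (simp add: \<W>_def J_eq)
  moreover have "finite \<W>"
    by (rule rev_finite_subset[OF _ subset_UNIV]) (simp add: Finite_Set.finite_set finite_type)
  ultimately obtain W where "W \<in> \<W>" and max: "\<And>V. V \<in> \<W> \<Longrightarrow> W \<subseteq> V \<Longrightarrow> W = V"
    using finite_has_maximal2[of \<W> J] by metis
  then have W: "scalar_submodule W" "J \<subseteq> W" "W \<inter> L \<subseteq> J" by (auto simp: \<W>_def)
  have "\<exists>y\<in>L. x - y \<in> W" for x
  proof (rule ccontr)
    assume no: "\<not> (\<exists>y\<in>L. x - y \<in> W)"
    define V where "V = {w + scalar r * x | w r. w \<in> W}"
    have "scalar_submodule V"
      unfolding scalar_submodule_def
    proof (intro conjI ballI allI)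
      show "0 \<in> V" using W(1) unfolding V_def scalar_submodule_def
        by (intro CollectI exI[of _ 0]) simp
      fix y assume "y \<in> V"
      then obtain w r where y: "y = w + scalar r * x" "w \<in> W" by (auto simp: V_def)
      {
        fix z assume "z \<in> V"
        then obtain w' r' where z: "z = w' + scalar r' * x" "w' \<in> W" by (auto simp: V_def)
        have "y + z = (w + w') + scalar (r + r') * x"
          using y z by (simp add: single_add algebra_simps)
        then show "y + z \<in> V" using y z W(1) unfolding V_def scalar_submodule_def by blast
      }
      fix s
      have "scalar s * y = scalar s * w + scalar (s * r) * x"
        using y by (simp add: distrib_left mult_single flip: mult.assoc)
      then show "scalar s * y \<in> V" using y W(1) unfolding V_def scalar_submodule_def by blast
    qed
    moreover have WV: "W \<subseteq> V"
    proof
      fix w assume "w \<in> W"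
      then show "w \<in> V" unfolding V_def by (intro CollectI exI[of _ w] exI[of _ 0]) simp
    qed
    moreover have "V \<inter> L \<subseteq> J"
    proof
      fix y assume y: "y \<in> V \<inter> L"
      then obtain w r where wr: "y = w + scalar r * x" "w \<in> W" by (auto simp: V_def)
      have "\<pi> dvd r"
      proof (rule ccontr)
        assume "\<not> \<pi> dvd r"
        then obtain s where s: "r * s = 1" using unit by (metis dvdE)
        have "x = scalar s * (scalar r * x)" using s by (simp add: mult_single mult.commute flip: mult.assoc)
        then have "x - scalar s * y = scalar s * (0 - w)" using wr by (simp add: algebra_simps)
        moreover have "scalar s * (0 - w) \<in> W"
          using scalar_submodule_diff[OF W(1)] W(1) wr(2) unfolding scalar_submodule_def by blast
        moreover have "scalar s * y \<in> L" using y L(1) unfolding scalar_submodule_def by blast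
        ultimately show False using no by metis
      qed
      then obtain s where "r = \<pi> * s" by (elim dvdE)
      then have "scalar r * x = scalar \<pi> * (scalar s * x)" by (simp add: mult_single flip: mult.assoc)
      then have "scalar r * x \<in> W" using W(2) J by blast
      then have "y \<in> W" using wr W(1) unfolding scalar_submodule_def by blast
      then show "y \<in> J" using y W(3) by blast
    qed
    ultimately have "V \<in> \<W>" using W(2) by (auto simp: \<W>_def)
    then have "W = V" using max WV by blast
    moreover have "x \<in> V" using W(1) unfolding V_def scalar_submodule_def
      by (intro CollectI exI[of _ 0] exI[of _ 1]) simp
    ultimately have "x - 0 \<in> W" by simp
    moreover have "0 \<in> L" using L(1) by (simp add: scalar_submodule_def)
    ultimately show False using no by blast
  qed
  with W show thesis by (rule that)
qed

lemma generator_mod_uniformizer: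
  fixes C :: "('g::{group_add,finite} \<Rightarrow>\<^sub>0 'r) set"
  assumes C: "left_ideal C" "relative_projective C" and k: "k < n"
  shows "\<exists>f. scalar \<pi> ^ k * f \<in> C \<and>
    (\<forall>x. scalar \<pi> ^ k * x \<in> C \<longrightarrow> x * f - x \<in> range ((*) (scalar \<pi>)))"
proof -
  define c where "c = (scalar \<pi> :: 'g \<Rightarrow>\<^sub>0 'r)"
  interpret nilpotent_central c n unfolding c_def by (rule nilpotent_central_uniformizer)
  have C_closed: "0 \<in> C" "x \<in> C \<Longrightarrow> y \<in> C \<Longrightarrow> x + y \<in> C" "x \<in> C \<Longrightarrow> b * x \<in> C" for x y b
    using C by (auto simp: left_ideal_def)
  have ann: "\<exists>y. x = c ^ (n - j) * y" if "j \<le> n" "c ^ j * x = 0" for j x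
    using annihilator_group_ring[of j x] that unfolding c_def by blast
  obtain \<theta> where \<theta>_C: "\<And>x. x \<in> C \<Longrightarrow> \<theta> x \<in> C"
    and \<theta>_add: "\<And>x y. x \<in> C \<Longrightarrow> y \<in> C \<Longrightarrow> \<theta> (x + y) = \<theta> x + \<theta> y"
    and \<theta>_scalar: "\<And>r x. x \<in> C \<Longrightarrow> \<theta> (scalar r * x) = scalar r * \<theta> x"
    and \<theta>_trace: "\<And>x. x \<in> C \<Longrightarrow>
      (\<Sum>g\<in>UNIV. Poly_Mapping.single g 1 * \<theta> (Poly_Mapping.single (- g) 1 * x)) = x"
    by (rule relative_projective_trace[OF C]) blast
  have \<theta>_power: "\<theta> (c ^ j * x) = c ^ j * \<theta> x" if "x \<in> C" for j x
    using \<theta>_scalar[OF that, of "\<pi> ^ j"] by (simp add: c_def scalar_power)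
  have \<theta>_0: "\<theta> 0 = 0" using \<theta>_scalar[OF C_closed(1), of 0] by simp
  have \<theta>_div: "\<exists>z. \<theta> (c ^ j * x) = c ^ j * z" if "c ^ j * x \<in> C" "j \<le> n" for j x
  proof -
    have "c ^ (n - j) * \<theta> (c ^ j * x) = \<theta> (c ^ (n - j) * (c ^ j * x))"
      using \<theta>_power[OF that(1)] by simp
    also have "\<dots> = \<theta> (c ^ n * x)" using that(2) by (simp flip: mult.assoc power_add)
    finally have "c ^ (n - j) * \<theta> (c ^ j * x) = 0" by (simp add: nilpotent \<theta>_0)
    then show ?thesis using ann[of "n - j"] that(2) by simp
  qed
  define L where "L = layer C k"
  have L_D: "x \<in> L" if "c ^ k * x \<in> C" for x
    using that unfolding L_def by (rule mem_layer)
  have J_L: "J \<subseteq> L"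
    unfolding L_def by (rule J_subset_layer[OF C(1)])
  have L: "scalar_submodule L"
    unfolding L_def by (rule left_ideal_scalar_submodule[OF left_ideal_layer[OF C(1)]])
  have J_eq: "J = range ((*) (scalar \<pi>))" unfolding J_def by (simp add: c_def)
  obtain W where W: "scalar_submodule W" "J \<subseteq> W" "W \<inter> L \<subseteq> J" "\<And>x. \<exists>y\<in>L. x - y \<in> W"
    using complement_mod_uniformizer[OF J_eq L J_L] by blast
  text \<open>Modulo \<open>J\<close>, \<open>lift\<close> is the graph of the projection onto \<open>L\<close> along \<open>W\<close>, followed by the map that
    \<open>\<theta>\<close> induces on \<open>L\<close>; \<open>f\<close> below is the value at 1 of its trace, which is linear over the group ring.\<close>
  define lift where "lift x z \<longleftrightarrow> (\<exists>y. x - y \<in> W \<and> c ^ k * y \<in> C \<and> c ^ k * z = \<theta> (c ^ k * y))" for x z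
  have lift_ex: "\<exists>z. lift x z" for x
  proof -
    obtain y j where y: "x - (y + j) \<in> W" "c ^ k * y \<in> C" "j \<in> J"
      using W(4)[of x] by (auto simp: L_def layer_def)
    have "x - y = (x - (y + j)) + j" by simp
    moreover have "j \<in> W" using W(2) y(3) by blast
    ultimately have "x - y \<in> W" using y W(1) unfolding scalar_submodule_def by metis
    then show ?thesis using \<theta>_div[OF y(2)] k y(2) unfolding lift_def by (metis less_imp_le)
  qed
  have lift_add: "lift (x + x') (z + z')" if l: "lift x z" "lift x' z'" for x x' z z'
  proof -
    obtain y y' where y: "x - y \<in> W" "c ^ k * y \<in> C" "c ^ k * z = \<theta> (c ^ k * y)"
      and y': "x' - y' \<in> W" "c ^ k * y' \<in> C" "c ^ k * z' = \<theta> (c ^ k * y')"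
      using l unfolding lift_def by blast
    have "(x + x') - (y + y') = (x - y) + (x' - y')" by simp
    then have "(x + x') - (y + y') \<in> W" using y y' W(1) unfolding scalar_submodule_def by metis
    then show ?thesis
      unfolding lift_def using y y' C_closed \<theta>_add by (intro exI[of _ "y + y'"]) (simp add: distrib_left)
  qed
  have lift_scalar: "lift (scalar r * x) (scalar r * z)" if l: "lift x z" for r x z
  proof -
    obtain y where y: "x - y \<in> W" "c ^ k * y \<in> C" "c ^ k * z = \<theta> (c ^ k * y)"
      using l unfolding lift_def by blast
    have comm: "c ^ k * (scalar r * t) = scalar r * (c ^ k * t)" for t
      by (metis scalar_central mult.assoc)
    have "scalar r * x - scalar r * y = scalar r * (x - y)" by (simp add: right_diff_distrib)
    then have "scalar r * x - scalar r * y \<in> W" using y W(1) unfolding scalar_submodule_def by metis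
    then show ?thesis
      unfolding lift_def using y C_closed \<theta>_scalar
      by (intro exI[of _ "scalar r * y"]) (simp add: comm)
  qed
  have lift_0: "z \<in> J" if l: "lift 0 z" for z
  proof -
    obtain y where y: "0 - y \<in> W" "c ^ k * y \<in> C" "c ^ k * z = \<theta> (c ^ k * y)"
      using l unfolding lift_def by blast
    have "y \<in> W"
      using scalar_submodule_diff[OF W(1) _ y(1), of 0] W(1) by (simp add: scalar_submodule_def)
    then have "y \<in> J" using L_D y(2) W(3) by blast
    then obtain y' where y': "c ^ k * y = c ^ Suc k * y'" by (auto simp: J_def power_commutes simp flip: mult.assoc)
    then obtain t where "\<theta> (c ^ k * y) = c ^ Suc k * t" using \<theta>_div[of "Suc k" y'] y(2) k by auto
    then have "c ^ k * (z - c * t) = 0"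
      using y(3) by (simp add: right_diff_distrib power_commutes flip: mult.assoc)
    then obtain b where "z - c * t = c ^ (n - k) * b" using ann k by fastforce
    moreover have "c ^ (n - k) * b \<in> J"
      using k unfolding J_def by (cases "n - k") (auto simp: mult.assoc)
    moreover have "c * t \<in> J" by (simp add: J_def)
    ultimately show ?thesis using J_closed(2) by (metis diff_add_cancel)
  qed
  have lift_unique: "z - z' \<in> J" if "lift x z" "lift x z'" for x z z'
    using lift_add[OF that(1) lift_scalar[OF that(2), of "- 1"]]
    by (intro lift_0) (simp add: single_uminus)
  have lift_sum: "lift (\<Sum>i\<in>I. f i) (\<Sum>i\<in>I. h i)" if "\<And>i. i \<in> I \<Longrightarrow> lift (f i) (h i)" for f h and I :: "'g set"
  proof -
    have "finite I" by simp
    then show ?thesis using that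
    proof (induction I rule: finite_induct)
      case empty
      show ?case
        unfolding lift_def using W(1) C_closed(1) by (intro exI[of _ 0]) (simp add: \<theta>_0 scalar_submodule_def)
    qed (simp add: lift_add)
  qed
  define z where "z g = (SOME y. lift (Poly_Mapping.single g 1) y)" for g
  have z: "lift (Poly_Mapping.single g 1) (z g)" for g
    unfolding z_def by (rule someI_ex[OF lift_ex])
  define f where "f = (\<Sum>g\<in>UNIV. Poly_Mapping.single g 1 * z (- g))"
  have pow_comm: "c ^ k * (s * t) = s * (c ^ k * t)" for s t
    by (metis central_power mult.assoc)
  show ?thesis
  proof (intro exI conjI allI impI)
    show "scalar \<pi> ^ k * f \<in> C"
    proof -
      have "c ^ k * z g \<in> C" for g using z[of g] \<theta>_C unfolding lift_def by metis
      then have "c ^ k * f \<in> C"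
        unfolding f_def sum_distrib_left pow_comm using C(1) C_closed(3) by (intro left_ideal_sum) auto
      then show ?thesis by (simp add: c_def)
    qed
    fix x assume "scalar \<pi> ^ k * x \<in> C"
    then have x: "c ^ k * x \<in> C" by (simp add: c_def)
    define X where "X = Poly_Mapping.lookup x"
    define q where "q g = (\<Sum>h\<in>UNIV. scalar (X h) * z (- g + h))" for g
    have "x * f = (\<Sum>h\<in>UNIV. \<Sum>g\<in>UNIV. Poly_Mapping.single h (X h) * (Poly_Mapping.single g 1 * z (- g)))"
      by (subst poly_mapping_sum_single[of x]) (simp add: f_def X_def sum_product)
    also have "\<dots> = (\<Sum>h\<in>UNIV. \<Sum>g\<in>UNIV. Poly_Mapping.single g (X h) * z (- g + h))"
    proof (rule sum.cong[OF refl])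
      fix h
      show "(\<Sum>g\<in>UNIV. Poly_Mapping.single h (X h) * (Poly_Mapping.single g 1 * z (- g))) =
        (\<Sum>g\<in>UNIV. Poly_Mapping.single g (X h) * z (- g + h))"
        by (rule sum.reindex_bij_witness[of _ "\<lambda>g. - h + g" "\<lambda>g. h + g"])
          (auto simp: minus_add mult_single add.assoc simp flip: mult.assoc)
    qed
    also have "\<dots> = (\<Sum>g\<in>UNIV. \<Sum>h\<in>UNIV. Poly_Mapping.single g (X h) * z (- g + h))"
      by (rule sum.swap)
    also have "\<dots> = (\<Sum>g\<in>UNIV. Poly_Mapping.single g 1 * q g)"
      by (simp add: q_def sum_distrib_left mult_single flip: mult.assoc)
    finally have xf: "x * f = (\<Sum>g\<in>UNIV. Poly_Mapping.single g 1 * q g)" .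
    have q: "lift (Poly_Mapping.single (- g) 1 * x) (q g)" for g
    proof -
      have "Poly_Mapping.single (- g) 1 * x = (\<Sum>h\<in>UNIV. scalar (X h) * Poly_Mapping.single (- g + h) 1)"
        by (subst poly_mapping_sum_single[of x]) (simp add: X_def sum_distrib_left mult_single)
      then show ?thesis unfolding q_def using lift_sum lift_scalar z by simp
    qed
    have gx: "c ^ k * (Poly_Mapping.single (- g) 1 * x) \<in> C" for g
      unfolding pow_comm using x C_closed(3) by blast
    obtain v where v: "\<And>g. c ^ k * v g = \<theta> (c ^ k * (Poly_Mapping.single (- g) 1 * x))"
      using \<theta>_div[OF gx] k by (metis less_imp_le)
    have "lift (Poly_Mapping.single (- g) 1 * x) (v g)" for g
      unfolding lift_def using W(1) v gx
      by (intro exI[of _ "Poly_Mapping.single (- g) 1 * x"]) (simp add: scalar_submodule_def)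
    then have qv: "q g - v g \<in> J" for g using lift_unique q by blast
    define y where "y = (\<Sum>g\<in>UNIV. Poly_Mapping.single g 1 * v g)"
    have "x * f - y = (\<Sum>g\<in>UNIV. Poly_Mapping.single g 1 * (q g - v g))"
      by (simp add: xf y_def right_diff_distrib sum_subtractf)
    then have xfy: "x * f - y \<in> J" by (auto intro!: left_ideal_sum[OF left_ideal_J] J_closed(3) qv)
    have "c ^ k * y = (\<Sum>g\<in>UNIV. Poly_Mapping.single g 1 * \<theta> (Poly_Mapping.single (- g) 1 * (c ^ k * x)))"
      by (simp add: y_def sum_distrib_left pow_comm v)
    then have "c ^ k * y = c ^ k * x" using \<theta>_trace[OF x] by simp
    then have "c ^ k * (y - x) = 0" by (simp add: right_diff_distrib)
    then obtain b where "y - x = c ^ (n - k) * b" using ann k by fastforce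
    moreover have "c ^ (n - k) * b \<in> J"
      using k unfolding J_def by (cases "n - k") (auto simp: mult.assoc)
    ultimately have "(x * f - y) + (y - x) \<in> J" using xfy J_closed(2) by metis
    then show "x * f - x \<in> range ((*) (scalar \<pi>))" by (simp add: J_eq)
  qed
qed

end

theorem theorem2p5:
  fixes \<pi> :: "'r::comm_ring_1" and \<mm> :: "'r set" and p :: nat
    and C :: "('g::{group_add,finite} \<Rightarrow>\<^sub>0 'r) set"
  assumes "artinian_ring TYPE('r)" and "chain_ring TYPE('r)"
    and "maximal_ideal \<mm>" and "\<mm> = range (\<lambda>r. \<pi> * r)"
    and "finite (residue_classes \<mm>)" and "residue_char \<mm> p"
    and "left_ideal C" and "relative_projective C"
  shows "\<exists>(s::nat) (\<epsilon> :: nat \<Rightarrow> ('g \<Rightarrow>\<^sub>0 'r)) (a :: nat \<Rightarrow> nat).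
    (\<forall>i\<in>{1..s}. primitive_idempotent (\<epsilon> i)) \<and>
    (\<forall>i\<in>{1..s}. \<forall>j\<in>{1..s}. i \<noteq> j \<longrightarrow> \<epsilon> i * \<epsilon> j = 0) \<and>
    is_direct_sum {1..s} (\<lambda>i. range (\<lambda>x. scalar (\<pi> ^ a i) * x * \<epsilon> i)) C"
proof -
  obtain n where "chain_ring_uniformizer \<pi> n"
    using artinian_chain_ring_uniformizer[OF assms(1-5)] .
  then interpret chain_ring_uniformizer \<pi> n .
  interpret nilpotent_central "scalar \<pi> :: 'g \<Rightarrow>\<^sub>0 'r" n by (rule nilpotent_central_uniformizer)
  obtain E a where E: "finite E" "\<And>x. x \<in> E \<Longrightarrow> primitive_idempotent x" "orthogonal_idempotents E"
    and E_C: "\<And>x y. x \<in> E \<Longrightarrow> scalar \<pi> ^ a x * y * x \<in> C"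
    and C_E: "\<And>x z. x \<in> E \<Longrightarrow> z \<in> C \<Longrightarrow> \<exists>y. z * x = scalar \<pi> ^ a x * y * x"
    and C_sum: "\<And>z. z \<in> C \<Longrightarrow> z * \<Sum>E = z"
    using direct_sum_of_primitive_idempotents[OF assms(7), unfolded J_def, OF generator_mod_uniformizer[OF assms(7,8)]]
    by blast
  obtain \<epsilon> where \<epsilon>: "bij_betw \<epsilon> {1..card E} E"
    using ex_bij_betw_nat_finite_1[OF E(1)] by blast
  let ?I = "{1..card E}"
  let ?D = "\<lambda>i. range (\<lambda>x. scalar (\<pi> ^ a (\<epsilon> i)) * x * \<epsilon> i)"
  have \<epsilon>_E: "\<epsilon> i \<in> E" if "i \<in> ?I" for i
    using \<epsilon> that bij_betwE by blast
  have \<epsilon>_ortho: "\<epsilon> i * \<epsilon> j = (if i = j then \<epsilon> i else 0)" if "i \<in> ?I" "j \<in> ?I" for i j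
    using E(3) \<epsilon>_E[OF that(1)] \<epsilon>_E[OF that(2)] inj_onD[OF bij_betw_imp_inj_on[OF \<epsilon>] _ that]
    unfolding orthogonal_idempotents_def by auto
  have \<epsilon>_sum: "(\<Sum>i\<in>?I. \<epsilon> i) = \<Sum>E"
    using sum.reindex_bij_betw[OF \<epsilon>, of "\<lambda>x. x"] by simp
  have D_\<epsilon>: "y * \<epsilon> j = (if i = j then y else 0)" if i: "i \<in> ?I" and j: "j \<in> ?I" and y: "y \<in> ?D i" for i j y
  proof -
    obtain x where "y = scalar (\<pi> ^ a (\<epsilon> i)) * x * \<epsilon> i" using y by blast
    then show ?thesis using \<epsilon>_ortho[OF i j] by (simp only: mult.assoc) simp
  qed
  have "is_direct_sum ?I ?D C"
    unfolding is_direct_sum_def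
  proof (rule bij_betw_byWitness[where f' = "\<lambda>z. restrict (\<lambda>i. z * \<epsilon> i) ?I"])
    show "\<forall>y\<in>Pi\<^sub>E ?I ?D. restrict (\<lambda>i. (\<Sum>i\<in>?I. y i) * \<epsilon> i) ?I = y"
    proof
      fix y assume y: "y \<in> Pi\<^sub>E ?I ?D"
      have "(\<Sum>i\<in>?I. y i) * \<epsilon> j = y j" if j: "j \<in> ?I" for j
      proof -
        have "y i * \<epsilon> j = (if i = j then y i else 0)" if i: "i \<in> ?I" for i
          using D_\<epsilon>[OF i j PiE_mem[OF y i]] .
        then have "(\<Sum>i\<in>?I. y i) * \<epsilon> j = (\<Sum>i\<in>?I. if i = j then y i else 0)"
          unfolding sum_distrib_right by (rule sum.cong[OF refl])
        then show ?thesis using j by simp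
      qed
      then show "restrict (\<lambda>i. (\<Sum>i\<in>?I. y i) * \<epsilon> i) ?I = y"
        using y by (intro ext) (auto simp: PiE_iff extensional_def)
    qed
    show "\<forall>z\<in>C. (\<Sum>i\<in>?I. restrict (\<lambda>i. z * \<epsilon> i) ?I i) = z"
      using C_sum unfolding \<epsilon>_sum[symmetric] by (simp add: sum_distrib_left)
    show "(\<lambda>y. \<Sum>i\<in>?I. y i) ` Pi\<^sub>E ?I ?D \<subseteq> C"
    proof safe
      fix y assume y: "y \<in> Pi\<^sub>E ?I ?D"
      have "?D i \<subseteq> C" if "i \<in> ?I" for i
        using E_C[OF \<epsilon>_E[OF that]] by (auto simp: scalar_power)
      then have "y i \<in> C" if "i \<in> ?I" for i using PiE_mem[OF y that] that by blast
      then show "(\<Sum>i\<in>?I. y i) \<in> C" by (rule left_ideal_sum[OF assms(7)])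
    qed
    show "(\<lambda>z. restrict (\<lambda>i. z * \<epsilon> i) ?I) ` C \<subseteq> Pi\<^sub>E ?I ?D"
      using C_E[OF \<epsilon>_E] by (fastforce simp: scalar_power PiE_iff)
  qed
  then show ?thesis
    using E(2) \<epsilon>_E \<epsilon>_ortho by (intro exI[of _ "card E"] exI[of _ \<epsilon>] exI[of _ "a \<circ> \<epsilon>"]) auto
qed

end
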